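(* Let $n\ge 3$ and let $R$ be a nearly local ring. Then $R$ is a stable ring (with respect to $n$).
   Context: An associative ring $R$ with identity is nearly local if for every $a\in R$ there exists $a'\in R$ such that $(1+a'a)(1-a'+aa')=0$. "Ideal" means two-sided ideal; $[a,b]=aba^{-1}b^{-1}$; for subgroups $A,B$, $[A,B]$ is the subgroup generated by all $[a,b]$, $a\in A$, $b\in B$. $e_{ij}$ are the standard matrix units, $t_{ij}(r)=1+re_{ij}$ ($i\ne j$, $r\in R$) are called transvections, and $E(n,R)$ is the subgroup of $GL(n,R)$ generated by all transvections. For an ideal $I$ of $R$: $E_I$ is the subgroup generated by all $t_{ij}(x)$, $x\in I$, $i\neq j$; $E(n,I)$ is the normal closure of $E_I$ in $E(n,R)$; $C(n,I)$ is the full preimage in $GL(n,R)$ of the center of $GL(n,R/I)$. An associative ring $R$ with identity is stable (with respect to $n$) if it is (a) commutator: for every ideal $I$ of $R$, $[C(n,I),E(n,R)]=E(n,I)$ and $E(n,I)$ is normal in $GL(n,R)$; and (b) normal: for every subgroup $G$ of $GL(n,R)$ normalized by $E(n,R)$ there is an ideal $I$ of $R$ with $E(n,I)\subseteq G\subseteq C(n,I)$. *)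

theory Defs
  imports
    "Jordan_Normal_Form.Matrix"
    "HOL-Algebra.QuotRing"
    "HOL-Algebra.Generated_Groups"
    "HOL-Algebra.Group_Action"
begin

text \<open>
  The ring \<open>R / I\<close> depends on \<open>I\<close>, so rings are HOL-Algebra records rather than type-class
  instances (\<^locale>\<open>ring\<close> requires neither commutativity nor \<open>\<one> \<noteq> \<zero>\<close>). The type
  \<^typ>\<open>'a mat\<close> is used only as a container: its own arithmetic needs type classes, hence
  the matrix ring below takes its operations from the record.
\<close>

subsection \<open>Groups\<close>

definition center :: "('a, 'b) monoid_scheme \<Rightarrow> 'a set" where
  "center G = {z \<in> carrier G. \<forall>g \<in> carrier G. z \<otimes>\<^bsub>G\<^esub> g = g \<otimes>\<^bsub>G\<^esub> z}"

definition commutator_subgroup :: "('a, 'b) monoid_scheme \<Rightarrow> 'a set \<Rightarrow> 'a set \<Rightarrow> 'a set" where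
  "commutator_subgroup G A B =
     generate G {a \<otimes>\<^bsub>G\<^esub> b \<otimes>\<^bsub>G\<^esub> inv\<^bsub>G\<^esub> a \<otimes>\<^bsub>G\<^esub> inv\<^bsub>G\<^esub> b | a b. a \<in> A \<and> b \<in> B}"

definition normal_closure :: "('a, 'b) monoid_scheme \<Rightarrow> 'a set \<Rightarrow> 'a set" where
  "normal_closure G S = \<Inter> {N. N \<lhd> G \<and> S \<subseteq> N}"

subsection \<open>Matrices over a ring\<close>

definition mat_ring :: "nat \<Rightarrow> ('a, 'b) ring_scheme \<Rightarrow> 'a mat ring" where
  "mat_ring n R =
     \<lparr>carrier = {A \<in> carrier_mat n n. elements_mat A \<subseteq> carrier R},
      mult = (\<lambda>A B. mat n n (\<lambda>(i, j). \<Oplus>\<^bsub>R\<^esub>k\<in>{..<n}. A $$ (i, k) \<otimes>\<^bsub>R\<^esub> B $$ (k, j))),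
      one = mat n n (\<lambda>(i, j). if i = j then \<one>\<^bsub>R\<^esub> else \<zero>\<^bsub>R\<^esub>),
      zero = mat n n (\<lambda>(i, j). \<zero>\<^bsub>R\<^esub>),
      add = (\<lambda>A B. mat n n (\<lambda>(i, j). A $$ (i, j) \<oplus>\<^bsub>R\<^esub> B $$ (i, j)))\<rparr>"

abbreviation GL :: "nat \<Rightarrow> ('a, 'b) ring_scheme \<Rightarrow> 'a mat monoid" where
  "GL n R \<equiv> units_of (mat_ring n R)"

text \<open>\<open>t\<^sub>i\<^sub>j(r) = 1 + r e\<^sub>i\<^sub>j\<close>, with rows and columns numbered from 0.\<close>

definition transvection ::
    "nat \<Rightarrow> ('a, 'b) ring_scheme \<Rightarrow> nat \<Rightarrow> nat \<Rightarrow> 'a \<Rightarrow> 'a mat" where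
  "transvection n R i j r =
     \<one>\<^bsub>mat_ring n R\<^esub> \<oplus>\<^bsub>mat_ring n R\<^esub> mat n n (\<lambda>(k, l). if k = i \<and> l = j then r else \<zero>\<^bsub>R\<^esub>)"

text \<open>The group \<open>E\<^sub>I\<close>; no normal closure is taken here.\<close>

definition elementary_gen :: "nat \<Rightarrow> ('a, 'b) ring_scheme \<Rightarrow> 'a set \<Rightarrow> 'a mat set" where
  "elementary_gen n R I =
     generate (GL n R) {transvection n R i j x | i j x. i < n \<and> j < n \<and> i \<noteq> j \<and> x \<in> I}"

text \<open>
  \<open>E(n,I)\<close> is the normal closure of \<open>E\<^sub>I\<close> in \<open>E(n,R)\<close>, not in \<open>GL(n,R)\<close>. \<open>C(n,I)\<close> refers to the
  center of all of \<open>GL(n,R/I)\<close>, not only of the image of \<open>GL(n,R)\<close>.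
\<close>

definition elementary_group :: "nat \<Rightarrow> ('a, 'b) ring_scheme \<Rightarrow> 'a mat set" where
  "elementary_group n R = elementary_gen n R (carrier R)"

definition elementary_ideal :: "nat \<Rightarrow> ('a, 'b) ring_scheme \<Rightarrow> 'a set \<Rightarrow> 'a mat set" where
  "elementary_ideal n R I =
     normal_closure ((GL n R)\<lparr>carrier := elementary_group n R\<rparr>) (elementary_gen n R I)"

definition congruence_full :: "nat \<Rightarrow> ('a, 'b) ring_scheme \<Rightarrow> 'a set \<Rightarrow> 'a mat set" where
  "congruence_full n R I =
     {A \<in> carrier (GL n R). map_mat (\<lambda>x. I +>\<^bsub>R\<^esub> x) A \<in> center (GL n (R Quot I))}"

subsection \<open>Nearly local and stable rings\<close>

locale nearly_local_ring = ring +
  assumes nearly_local: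
    "a \<in> carrier R \<Longrightarrow>
       \<exists>a' \<in> carrier R. (\<one> \<oplus> a' \<otimes> a) \<otimes> ((\<one> \<ominus> a') \<oplus> a \<otimes> a') = \<zero>"

definition commutator_ring :: "nat \<Rightarrow> ('a, 'b) ring_scheme \<Rightarrow> bool" where
  "commutator_ring n R \<longleftrightarrow>
     (\<forall>I. ideal I R \<longrightarrow>
        commutator_subgroup (GL n R) (congruence_full n R I) (elementary_group n R)
          = elementary_ideal n R I \<and>
        elementary_ideal n R I \<lhd> GL n R)"

definition normal_ring :: "nat \<Rightarrow> ('a, 'b) ring_scheme \<Rightarrow> bool" where
  "normal_ring n R \<longleftrightarrow>
     (\<forall>G. subgroup G (GL n R) \<and> elementary_group n R \<subseteq> normalizer (GL n R) G \<longrightarrow>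
        (\<exists>I. ideal I R \<and> elementary_ideal n R I \<subseteq> G \<and> G \<subseteq> congruence_full n R I))"

definition stable_ring :: "nat \<Rightarrow> ('a, 'b) ring_scheme \<Rightarrow> bool" where
  "stable_ring n R \<longleftrightarrow> ring R \<and> commutator_ring n R \<and> normal_ring n R"

end

theory Submission
imports Defs
begin

text \<open>
  Applied twice, near locality lets every \<open>a\<close> split \<open>1 = d\<^sub>1 + d\<^sub>2\<close> with \<open>d\<^sub>1 \<in> R a d\<^sub>1\<close> and
  \<open>d\<^sub>2 \<in> R (1 - a) d\<^sub>2\<close>; nothing else about \<open>R\<close> is used.

  A conjugate of a transvection is \<open>1 + u x v\<close>, where \<open>u\<close> is a column of \<open>g\<close> and \<open>v\<close> a row of
  \<open>g\<^sup>-\<^sup>1\<close> with \<open>v u = 0\<close>. Let \<open>w\<close> be the row of \<open>g\<^sup>-\<^sup>1\<close> with \<open>w u = 1\<close> and split for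
  \<open>a = w\<^sub>k u\<^sub>k\<close>. Then \<open>1 + u x v = (1 + u d\<^sub>1 x v) (1 + u d\<^sub>2 x v)\<close>, and an elementary matrix brings
  each of the columns \<open>u d\<^sub>1\<close>, \<open>u d\<^sub>2\<close> to one with a zero coordinate. In that case \<open>1 + u x v\<close> is
  essentially a commutator of unipotent matrices, so it lies in \<open>E(n,I)\<close> for \<open>x \<in> I\<close>. The same
  decomposition, carried out modulo \<open>I\<close>, gives \<open>[C(n,I), E(n,R)] \<subseteq> E(n,I)\<close>.

  For the sandwich condition one passes to the quotient by the largest \<open>I\<close> with
  \<open>E(n,I) \<subseteq> G\<close>, so that \<open>G\<close> contains no nontrivial transvection. Then an element of \<open>G\<close> with
  a trivial row is \<open>1\<close>. Applied to conjugates of \<open>[g, t\<^sub>i\<^sub>j(d)]\<close>, where \<open>d\<close> comes from a splitting, this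
  shows first that the off-diagonal entries of every \<open>g \<in> G\<close> lie in the Jacobson radical, hence that
  its diagonal entries are left invertible, and then that \<open>g\<close> is diagonal, hence central.
\<close>

text \<open>The setup of \<open>algebra\<close> for noncommutative rings lacks the right unit law.\<close>

lemmas (in ring) ring_r_one
  [algebra ring "zero R" "add R" "a_inv R" "a_minus R" "one R" "mult R"] = r_one

section \<open>Matrix rings\<close>

locale matrix_ring = ring R for R (structure) + fixes n :: nat
begin

abbreviation M where "M \<equiv> mat_ring n R"

abbreviation mmult (infixl "\<cdot>" 70) where "A \<cdot> B \<equiv> A \<otimes>\<^bsub>M\<^esub> B"
abbreviation madd (infixl "\<^bold>+" 65) where "A \<^bold>+ B \<equiv> A \<oplus>\<^bsub>M\<^esub> B"
abbreviation mminus (infixl "\<^bold>-" 65) where "A \<^bold>- B \<equiv> A \<ominus>\<^bsub>M\<^esub> B"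
abbreviation mone ("\<^bold>1") where "\<^bold>1 \<equiv> \<one>\<^bsub>M\<^esub>"
abbreviation mzero ("\<^bold>0") where "\<^bold>0 \<equiv> \<zero>\<^bsub>M\<^esub>"
abbreviation E where "E \<equiv> elementary_group n R"
abbreviation minv where "minv A \<equiv> inv\<^bsub>M\<^esub> A"

text \<open>The multiple r e_ij of a matrix unit, so that 1 + \<open>U i j r\<close> is the
  transvection t_ij(r). Computations can then take place inside the matrix ring.\<close>

definition U :: "nat \<Rightarrow> nat \<Rightarrow> 'a \<Rightarrow> 'a mat" where
  "U i j r = mat n n (\<lambda>(k, l). if k = i \<and> l = j then r else \<zero>)"

lemma carrier_M_iff:
  "A \<in> carrier M \<longleftrightarrow> dim_row A = n \<and> dim_col A = n \<and> (\<forall>i<n. \<forall>j<n. A $$ (i, j) \<in> carrier R)"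
proof
  assume "A \<in> carrier M"
  then have A: "dim_row A = n" "dim_col A = n" and el: "elements_mat A \<subseteq> carrier R"
    by (auto simp: mat_ring_def)
  have "A $$ (i, j) \<in> carrier R" if "i < n" "j < n" for i j
    using that A by (intro subsetD[OF el] elements_matI[of A n n i j]) (auto intro: carrier_matI)
  with A show "dim_row A = n \<and> dim_col A = n \<and> (\<forall>i<n. \<forall>j<n. A $$ (i, j) \<in> carrier R)"
    by blast
next
  assume A: "dim_row A = n \<and> dim_col A = n \<and> (\<forall>i<n. \<forall>j<n. A $$ (i, j) \<in> carrier R)"
  have "elements_mat A \<subseteq> carrier R"
  proof
    fix a assume "a \<in> elements_mat A"
    then obtain i j where "i < dim_row A" "j < dim_col A" "a = A $$ (i, j)"
      by (auto dest!: elements_matD)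
    with A show "a \<in> carrier R" by simp
  qed
  with A show "A \<in> carrier M" by (auto simp: mat_ring_def intro: carrier_matI)
qed

lemma mat_closed [intro]:
  "(\<And>i j. i < n \<Longrightarrow> j < n \<Longrightarrow> f (i, j) \<in> carrier R) \<Longrightarrow> mat n n f \<in> carrier M"
  by (simp add: carrier_M_iff)

lemma entry_closed [simp, intro]:
  "A \<in> carrier M \<Longrightarrow> i < n \<Longrightarrow> j < n \<Longrightarrow> A $$ (i, j) \<in> carrier R"
  by (auto simp: carrier_M_iff)

lemma dim_M [simp]: "A \<in> carrier M \<Longrightarrow> dim_row A = n" "A \<in> carrier M \<Longrightarrow> dim_col A = n"
  by (auto simp: carrier_M_iff)

lemma mat_eqI:
  assumes "A \<in> carrier M" "B \<in> carrier M"
    and "\<And>i j. i < n \<Longrightarrow> j < n \<Longrightarrow> A $$ (i, j) = B $$ (i, j)"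
  shows "A = B"
  using assms by (intro eq_matI) auto

lemma M_ops:
  "A \<^bold>+ B = mat n n (\<lambda>(i, j). A $$ (i, j) \<oplus> B $$ (i, j))"
  "A \<cdot> B = mat n n (\<lambda>(i, j). \<Oplus>k\<in>{..<n}. A $$ (i, k) \<otimes> B $$ (k, j))"
  "\<^bold>1 = mat n n (\<lambda>(i, j). if i = j then \<one> else \<zero>)"
  "\<^bold>0 = mat n n (\<lambda>(i, j). \<zero>)"
  by (simp_all add: mat_ring_def)

lemma entry_add [simp]:
  "i < n \<Longrightarrow> j < n \<Longrightarrow> (A \<^bold>+ B) $$ (i, j) = A $$ (i, j) \<oplus> B $$ (i, j)"
  by (simp add: M_ops)

lemma entry_mult:
  "i < n \<Longrightarrow> j < n \<Longrightarrow> (A \<cdot> B) $$ (i, j) = (\<Oplus>k\<in>{..<n}. A $$ (i, k) \<otimes> B $$ (k, j))"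
  by (simp add: M_ops)

lemma entry_one [simp]: "i < n \<Longrightarrow> j < n \<Longrightarrow> \<^bold>1 $$ (i, j) = (if i = j then \<one> else \<zero>)"
  by (simp add: M_ops)

lemma entry_zero [simp]: "i < n \<Longrightarrow> j < n \<Longrightarrow> \<^bold>0 $$ (i, j) = \<zero>"
  by (simp add: M_ops)

lemma M_closed [simp, intro]:
  "\<^bold>1 \<in> carrier M" "\<^bold>0 \<in> carrier M"
  "A \<in> carrier M \<Longrightarrow> B \<in> carrier M \<Longrightarrow> A \<^bold>+ B \<in> carrier M"
  "A \<in> carrier M \<Longrightarrow> B \<in> carrier M \<Longrightarrow> A \<cdot> B \<in> carrier M"
  by (auto simp: M_ops intro!: mat_closed finsum_closed)

lemma finsum_swap:
  assumes "finite A" "finite B" "\<And>x y. x \<in> A \<Longrightarrow> y \<in> B \<Longrightarrow> f x y \<in> carrier R"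
  shows "(\<Oplus>x\<in>A. \<Oplus>y\<in>B. f x y) = (\<Oplus>y\<in>B. \<Oplus>x\<in>A. f x y)"
  using assms(1,3)
proof (induction A rule: finite_induct)
  case empty
  then show ?case by simp
next
  case (insert a A)
  have "(\<Oplus>x\<in>insert a A. \<Oplus>y\<in>B. f x y) = (\<Oplus>y\<in>B. f a y) \<oplus> (\<Oplus>y\<in>B. \<Oplus>x\<in>A. f x y)"
    using insert by (subst finsum_insert) (auto intro!: finsum_closed)
  also have "\<dots> = (\<Oplus>y\<in>B. f a y \<oplus> (\<Oplus>x\<in>A. f x y))"
    using insert by (subst finsum_addf) (auto intro!: finsum_closed)
  also have "\<dots> = (\<Oplus>y\<in>B. \<Oplus>x\<in>insert a A. f x y)"
    using insert by (intro finsum_cong') (auto simp: finsum_insert Pi_def intro!: finsum_closed)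
  finally show ?case .
qed

lemma finsum_delta:
  assumes "finite A" "i \<in> A" "\<And>k. k \<in> A \<Longrightarrow> k \<noteq> i \<Longrightarrow> f k = \<zero>" "f i \<in> carrier R"
  shows "(\<Oplus>k\<in>A. f k) = f i"
proof -
  have "(\<Oplus>k\<in>A. f k) = (\<Oplus>k\<in>insert i (A - {i}). f k)"
    using assms by (simp add: insert_absorb)
  also have "\<dots> = f i \<oplus> (\<Oplus>k\<in>A - {i}. f k)"
    using assms by (subst finsum_insert) auto
  also have "(\<Oplus>k\<in>A - {i}. f k) = (\<Oplus>k\<in>A - {i}. \<zero>)"
    using assms by (intro finsum_cong') auto
  finally show ?thesis using assms by simp
qed

lemma M_assoc:
  assumes "A \<in> carrier M" "B \<in> carrier M" "C \<in> carrier M"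
  shows "A \<cdot> B \<cdot> C = A \<cdot> (B \<cdot> C)"
proof (rule mat_eqI)
  fix i j assume ij: "i < n" "j < n"
  have "(A \<cdot> B \<cdot> C) $$ (i, j) =
      (\<Oplus>k\<in>{..<n}. \<Oplus>l\<in>{..<n}. A $$ (i, l) \<otimes> B $$ (l, k) \<otimes> C $$ (k, j))"
    using assms ij by (auto simp: entry_mult finsum_ldistr intro!: finsum_cong' finsum_closed)
  also have "\<dots> = (\<Oplus>l\<in>{..<n}. \<Oplus>k\<in>{..<n}. A $$ (i, l) \<otimes> B $$ (l, k) \<otimes> C $$ (k, j))"
    using assms ij by (intro finsum_swap) auto
  also have "\<dots> = (A \<cdot> (B \<cdot> C)) $$ (i, j)"
    using assms ij
    by (auto simp: entry_mult finsum_rdistr m_assoc intro!: finsum_cong' finsum_closed)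
  finally show "(A \<cdot> B \<cdot> C) $$ (i, j) = (A \<cdot> (B \<cdot> C)) $$ (i, j)" .
qed (simp_all add: assms)

lemma ring_M: "ring M"
proof (rule ringI)
  show "abelian_group M"
  proof (rule abelian_groupI)
    fix A assume A: "A \<in> carrier M"
    let ?B = "mat n n (\<lambda>(i, j). \<ominus> (A $$ (i, j)))"
    have "?B \<in> carrier M" using A by (intro mat_closed) simp
    moreover have "?B \<^bold>+ A = \<^bold>0"
      using A calculation by (intro mat_eqI) (auto simp: l_neg)
    ultimately show "\<exists>B\<in>carrier M. B \<^bold>+ A = \<^bold>0" by blast
  next
    fix A B C assume "A \<in> carrier M" "B \<in> carrier M" "C \<in> carrier M"
    then show "A \<^bold>+ B \<^bold>+ C = A \<^bold>+ (B \<^bold>+ C)" by (intro mat_eqI) (auto simp: a_assoc)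
  next
    fix A B assume "A \<in> carrier M" "B \<in> carrier M"
    then show "A \<^bold>+ B = B \<^bold>+ A" by (intro mat_eqI) (auto simp: a_comm)
  next
    fix A assume "A \<in> carrier M"
    then show "\<^bold>0 \<^bold>+ A = A" by (intro mat_eqI) auto
  qed auto
  show "monoid M"
  proof (rule monoidI)
    fix A assume A: "A \<in> carrier M"
    show "\<^bold>1 \<cdot> A = A"
    proof (rule mat_eqI)
      fix i j assume ij: "i < n" "j < n"
      then show "(\<^bold>1 \<cdot> A) $$ (i, j) = A $$ (i, j)"
        using A by (subst entry_mult, simp, simp, subst finsum_delta[where i = i]) auto
    qed (use A in auto)
    show "A \<cdot> \<^bold>1 = A"
    proof (rule mat_eqI)
      fix i j assume ij: "i < n" "j < n"
      then show "(A \<cdot> \<^bold>1) $$ (i, j) = A $$ (i, j)"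
        using A by (subst entry_mult, simp, simp, subst finsum_delta[where i = j]) auto
    qed (use A in auto)
  qed (use M_assoc in auto)
next
  fix A B C assume ABC: "A \<in> carrier M" "B \<in> carrier M" "C \<in> carrier M"
  show "(A \<^bold>+ B) \<cdot> C = A \<cdot> C \<^bold>+ B \<cdot> C"
  proof (rule mat_eqI)
    fix i j assume ij: "i < n" "j < n"
    have "((A \<^bold>+ B) \<cdot> C) $$ (i, j) = (\<Oplus>k\<in>{..<n}. A $$ (i, k) \<otimes> C $$ (k, j) \<oplus> B $$ (i, k) \<otimes> C $$ (k, j))"
      using ABC ij unfolding entry_mult[OF ij] by (intro finsum_cong') (auto simp: l_distr)
    also have "\<dots> = (A \<cdot> C \<^bold>+ B \<cdot> C) $$ (i, j)"
      using ABC ij by (subst finsum_addf) (auto simp: entry_mult)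
    finally show "((A \<^bold>+ B) \<cdot> C) $$ (i, j) = (A \<cdot> C \<^bold>+ B \<cdot> C) $$ (i, j)" .
  qed (use ABC in auto)
  show "C \<cdot> (A \<^bold>+ B) = C \<cdot> A \<^bold>+ C \<cdot> B"
  proof (rule mat_eqI)
    fix i j assume ij: "i < n" "j < n"
    have "(C \<cdot> (A \<^bold>+ B)) $$ (i, j) = (\<Oplus>k\<in>{..<n}. C $$ (i, k) \<otimes> A $$ (k, j) \<oplus> C $$ (i, k) \<otimes> B $$ (k, j))"
      using ABC ij unfolding entry_mult[OF ij] by (intro finsum_cong') (auto simp: r_distr)
    also have "\<dots> = (C \<cdot> A \<^bold>+ C \<cdot> B) $$ (i, j)"
      using ABC ij by (subst finsum_addf) (auto simp: entry_mult)
    finally show "(C \<cdot> (A \<^bold>+ B)) $$ (i, j) = (C \<cdot> A \<^bold>+ C \<cdot> B) $$ (i, j)" .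
  qed (use ABC in auto)
qed

sublocale M: ring M by (rule ring_M)

lemma U_closed [simp, intro]: "r \<in> carrier R \<Longrightarrow> U i j r \<in> carrier M"
  by (auto simp: U_def)

lemma entry_U [simp]:
  "k < n \<Longrightarrow> l < n \<Longrightarrow> U i j r $$ (k, l) = (if k = i \<and> l = j then r else \<zero>)"
  by (simp add: U_def)

lemma entry_uminus [simp]:
  assumes "A \<in> carrier M" "i < n" "j < n"
  shows "(\<ominus>\<^bsub>M\<^esub> A) $$ (i, j) = \<ominus> (A $$ (i, j))"
proof -
  have "(\<ominus>\<^bsub>M\<^esub> A) $$ (i, j) \<oplus> A $$ (i, j) = \<zero>"
    using M.l_neg[OF assms(1)] assms by (metis entry_add entry_zero)
  then show ?thesis
    using assms by (metis M.a_inv_closed entry_closed minus_equality)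
qed

lemma entry_minus [simp]:
  "A \<in> carrier M \<Longrightarrow> B \<in> carrier M \<Longrightarrow> i < n \<Longrightarrow> j < n \<Longrightarrow>
    (A \<^bold>- B) $$ (i, j) = A $$ (i, j) \<ominus> B $$ (i, j)"
  by (simp add: M.minus_eq minus_eq)

lemma entry_U_mult [simp]:
  assumes "A \<in> carrier M" "r \<in> carrier R" "j < n" "k < n" "l < n"
  shows "(U i j r \<cdot> A) $$ (k, l) = (if k = i then r \<otimes> A $$ (j, l) else \<zero>)"
  using assms by (subst entry_mult, simp, simp, subst finsum_delta[where i = j]) auto

lemma entry_mult_U [simp]:
  assumes "A \<in> carrier M" "r \<in> carrier R" "i < n" "k < n" "l < n"
  shows "(A \<cdot> U i j r) $$ (k, l) = (if l = j then A $$ (k, i) \<otimes> r else \<zero>)"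
  using assms by (subst entry_mult, simp, simp, subst finsum_delta[where i = i]) auto

lemma U_mult_U:
  assumes "r \<in> carrier R" "s \<in> carrier R" "j < n" "k < n"
  shows "U i j r \<cdot> U k l s = (if j = k then U i l (r \<otimes> s) else \<^bold>0)"
  using assms by (intro mat_eqI) (auto)

text \<open>Matrix units on both sides isolate one entry; in this way statements about entries
  become identities in the matrix ring.\<close>

lemma U_sandwich:
  assumes "A \<in> carrier M" "r \<in> carrier R" "s \<in> carrier R" "j < n" "k < n"
  shows "U i j r \<cdot> A \<cdot> U k l s = U i l (r \<otimes> A $$ (j, k) \<otimes> s)"
  using assms by (intro mat_eqI) (auto)

lemma U_add: "r \<in> carrier R \<Longrightarrow> s \<in> carrier R \<Longrightarrow> U i j (r \<oplus> s) = U i j r \<^bold>+ U i j s"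
  by (intro mat_eqI) auto

lemma U_uminus: "r \<in> carrier R \<Longrightarrow> U i j (\<ominus> r) = \<ominus>\<^bsub>M\<^esub> U i j r"
  by (intro mat_eqI) auto

lemma U_zero [simp]: "U i j \<zero> = \<^bold>0"
  by (intro mat_eqI) auto

lemma transvection_eq: "transvection n R i j r = \<^bold>1 \<^bold>+ U i j r"
  by (simp add: transvection_def U_def)

end

section \<open>Normal closures inside a subgroup\<close>

lemma subset_normal_closure: "S \<subseteq> normal_closure H S"
  by (auto simp: normal_closure_def)

context group
begin

text \<open>Multiplication and inverse on the restricted carrier agree with those of the ambient
  group, so normality inside \<open>E\<close> can be expressed in \<open>G\<close>.\<close>

lemma normal_subgroup_iff:
  assumes "subgroup E G"
  shows "N \<lhd> G\<lparr>carrier := E\<rparr> \<longleftrightarrow>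
    subgroup N G \<and> N \<subseteq> E \<and> (\<forall>e\<in>E. \<forall>x\<in>N. e \<otimes> x \<otimes> inv e \<in> N)"
proof -
  have grp: "group (G\<lparr>carrier := E\<rparr>)"
    using assms by (rule subgroup_imp_group)
  have "subgroup N (G\<lparr>carrier := E\<rparr>) \<longleftrightarrow> subgroup N G \<and> N \<subseteq> E"
  proof
    assume N: "subgroup N (G\<lparr>carrier := E\<rparr>)"
    show "subgroup N G \<and> N \<subseteq> E"
      using incl_subgroup[OF assms N] subgroup.subset[OF N] by simp
  next
    assume "subgroup N G \<and> N \<subseteq> E"
    then show "subgroup N (G\<lparr>carrier := E\<rparr>)"
      using assms by (intro subgroup_incl) auto
  qed
  moreover have "inv\<^bsub>G\<lparr>carrier := E\<rparr>\<^esub> e = inv e" if "e \<in> E" for e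
    using assms that by (rule m_inv_consistent)
  ultimately show ?thesis
    unfolding group.normal_inv_iff[OF grp] by simp
qed

text \<open>As \<open>H\<close> need not lie in \<open>E\<close>, the minimality of the normal
  closure is applied to \<open>H \<inter> E\<close>, which is normal in \<open>E\<close>.\<close>

lemma normal_closure_mono:
  assumes "subgroup E G" "subgroup H G" "S \<subseteq> H" "S \<subseteq> E"
    and "\<And>e h. e \<in> E \<Longrightarrow> h \<in> H \<Longrightarrow> e \<otimes> h \<otimes> inv e \<in> H"
  shows "normal_closure (G\<lparr>carrier := E\<rparr>) S \<subseteq> H"
proof -
  have "e \<otimes> h \<otimes> inv e \<in> E" if "e \<in> E" "h \<in> E" for e h
    using that assms(1) by (meson subgroup.m_closed subgroup.m_inv_closed)
  then have "H \<inter> E \<lhd> G\<lparr>carrier := E\<rparr>"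
    unfolding normal_subgroup_iff[OF assms(1)]
    using assms(5) subgroups_Inter_pair[OF assms(2,1)] by auto
  then show ?thesis
    using assms(3,4) by (auto simp: normal_closure_def)
qed

lemma normal_closure_normal:
  assumes "subgroup E G" "S \<subseteq> E"
  shows "normal_closure (G\<lparr>carrier := E\<rparr>) S \<lhd> G\<lparr>carrier := E\<rparr>"
proof -
  let ?F = "{N. N \<lhd> G\<lparr>carrier := E\<rparr> \<and> S \<subseteq> N}"
  have F: "subgroup N G" "N \<subseteq> E" "e \<in> E \<Longrightarrow> x \<in> N \<Longrightarrow> e \<otimes> x \<otimes> inv e \<in> N"
    if "N \<in> ?F" for N e x
    using that by (auto simp: normal_subgroup_iff[OF assms(1)])
  \<comment> \<open>The family is nonempty, so its intersection is a subgroup.\<close>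
  have "E \<in> ?F"
    using assms unfolding mem_Collect_eq normal_subgroup_iff[OF assms(1)]
    by (meson order_refl subgroup.m_closed subgroup.m_inv_closed)
  moreover from this have "subgroup (\<Inter>?F) G"
    using F by (intro subgroups_Inter) auto
  ultimately show ?thesis
    unfolding normal_closure_def normal_subgroup_iff[OF assms(1)]
    using F by blast
qed

end

section \<open>Elementary groups\<close>

lemma (in ring) one_plus_square_zero:
  assumes "X \<in> carrier R" "X \<otimes> X = \<zero>"
  shows "\<one> \<oplus> X \<in> Units R" "inv (\<one> \<oplus> X) = \<one> \<ominus> X"
proof -
  have "(\<one> \<oplus> X) \<otimes> (\<one> \<ominus> X) = \<one> \<ominus> X \<otimes> X" "(\<one> \<ominus> X) \<otimes> (\<one> \<oplus> X) = \<one> \<ominus> X \<otimes> X"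
    using assms(1) by (algebra, algebra)
  then have *: "(\<one> \<oplus> X) \<otimes> (\<one> \<ominus> X) = \<one>" "(\<one> \<ominus> X) \<otimes> (\<one> \<oplus> X) = \<one>"
    using assms by (simp_all add: minus_eq)
  have X: "\<one> \<oplus> X \<in> carrier R" "\<one> \<ominus> X \<in> carrier R"
    using assms(1) by simp_all
  show "\<one> \<oplus> X \<in> Units R"
    unfolding Units_def using X * by blast
  show "inv (\<one> \<oplus> X) = \<one> \<ominus> X"
    using X * by (rule inv_char)
qed

context matrix_ring
begin

lemma GL_group: "group (GL n R)"
  by (rule M.units_group)

lemmas GL_simps = units_of_carrier units_of_mult units_of_one

lemma GL_inv: "A \<in> Units M \<Longrightarrow> inv\<^bsub>GL n R\<^esub> A = minv A"
  by (rule M.units_of_inv)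

lemma GL_subgroupD:
  assumes "subgroup H (GL n R)"
  shows "H \<subseteq> Units M" "\<^bold>1 \<in> H"
    "x \<in> H \<Longrightarrow> y \<in> H \<Longrightarrow> x \<cdot> y \<in> H"
    "x \<in> H \<Longrightarrow> minv x \<in> H"
  using subgroup.subset[OF assms] subgroup.one_closed[OF assms]
    subgroup.m_closed[OF assms, of x y] subgroup.m_inv_closed[OF assms, of x]
  by (auto simp: GL_simps GL_inv subset_iff)

lemma GL_subgroupI:
  assumes "H \<subseteq> Units M" "\<^bold>1 \<in> H"
    and "\<And>x y. x \<in> H \<Longrightarrow> y \<in> H \<Longrightarrow> x \<cdot> y \<in> H"
    and "\<And>x. x \<in> H \<Longrightarrow> minv x \<in> H"
  shows "subgroup H (GL n R)"
  using assms
  by unfold_locales (auto simp: GL_simps GL_inv subset_iff)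

lemma U_square_zero:
  assumes "i < n" "j < n" "i \<noteq> j" "r \<in> carrier R"
  shows "U i j r \<cdot> U i j r = \<^bold>0"
  using assms by (simp add: U_mult_U)

lemma transvection_unit:
  assumes "i < n" "j < n" "i \<noteq> j" "r \<in> carrier R"
  shows "\<^bold>1 \<^bold>+ U i j r \<in> Units M" "minv (\<^bold>1 \<^bold>+ U i j r) = \<^bold>1 \<^bold>- U i j r"
  using M.one_plus_square_zero[OF _ U_square_zero[OF assms]] assms by auto

lemma elementary_gen_subgroup:
  assumes "I \<subseteq> carrier R"
  shows "subgroup (elementary_gen n R I) (GL n R)"
  unfolding elementary_gen_def
  using assms transvection_unit by (intro group.generate_is_subgroup[OF GL_group]) (auto simp: transvection_eq GL_simps)

lemma transvection_in_elementary_gen: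
  assumes "i < n" "j < n" "i \<noteq> j" "x \<in> I"
  shows "\<^bold>1 \<^bold>+ U i j x \<in> elementary_gen n R I"
  unfolding elementary_gen_def using assms by (intro generate.incl) (auto simp: transvection_eq GL_simps)

lemma E_subgroup: "subgroup E (GL n R)"
  unfolding elementary_group_def by (rule elementary_gen_subgroup) simp

lemma transvection_in_E:
  "i < n \<Longrightarrow> j < n \<Longrightarrow> i \<noteq> j \<Longrightarrow> x \<in> carrier R \<Longrightarrow> \<^bold>1 \<^bold>+ U i j x \<in> E"
  unfolding elementary_group_def by (rule transvection_in_elementary_gen)

lemma elementary_gen_minimal:
  assumes "subgroup H (GL n R)"
    and "\<And>i j x. i < n \<Longrightarrow> j < n \<Longrightarrow> i \<noteq> j \<Longrightarrow> x \<in> I \<Longrightarrow> \<^bold>1 \<^bold>+ U i j x \<in> H"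
  shows "elementary_gen n R I \<subseteq> H"
  unfolding elementary_gen_def
  using assms(2) by (intro group.generate_subgroup_incl[OF GL_group _ assms(1)]) (auto simp: transvection_eq GL_simps)

lemma elementary_gen_subset_E:
  assumes "I \<subseteq> carrier R"
  shows "elementary_gen n R I \<subseteq> E"
  using assms by (intro elementary_gen_minimal[OF E_subgroup] transvection_in_E) auto

lemma E_subset_Units: "E \<subseteq> Units M"
  using GL_subgroupD(1)[OF E_subgroup] .

lemma elementary_ideal:
  assumes "I \<subseteq> carrier R"
  shows "subgroup (elementary_ideal n R I) (GL n R)"
    and "elementary_ideal n R I \<subseteq> E"
    and "elementary_gen n R I \<subseteq> elementary_ideal n R I"
    and "e \<in> E \<Longrightarrow> x \<in> elementary_ideal n R I \<Longrightarrow> e \<cdot> x \<cdot> minv e \<in> elementary_ideal n R I"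
proof -
  have "elementary_ideal n R I \<lhd> (GL n R)\<lparr>carrier := E\<rparr>"
    unfolding elementary_ideal_def
    by (intro group.normal_closure_normal[OF GL_group] E_subgroup elementary_gen_subset_E assms)
  note * = this[unfolded group.normal_subgroup_iff[OF GL_group E_subgroup]]
  show "subgroup (elementary_ideal n R I) (GL n R)" "elementary_ideal n R I \<subseteq> E"
    using * by blast+
  show "elementary_gen n R I \<subseteq> elementary_ideal n R I"
    unfolding elementary_ideal_def by (rule subset_normal_closure)
  show "e \<cdot> x \<cdot> minv e \<in> elementary_ideal n R I" if "e \<in> E" "x \<in> elementary_ideal n R I"
  proof -
    have "e \<in> Units M" using that(1) E_subset_Units by blast
    with * that show ?thesis by (metis GL_inv units_of_mult)
  qed
qed

text \<open>The tool for showing that a subgroup of GL(n,R) contains E(n,I); the group E_I enters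
  only through its generators.\<close>

lemma elementary_ideal_minimal:
  assumes "I \<subseteq> carrier R" "subgroup H (GL n R)"
    and "\<And>i j x. i < n \<Longrightarrow> j < n \<Longrightarrow> i \<noteq> j \<Longrightarrow> x \<in> I \<Longrightarrow> \<^bold>1 \<^bold>+ U i j x \<in> H"
    and "\<And>e h. e \<in> E \<Longrightarrow> h \<in> H \<Longrightarrow> e \<cdot> h \<cdot> minv e \<in> H"
  shows "elementary_ideal n R I \<subseteq> H"
  unfolding elementary_ideal_def
  using assms GL_inv E_subset_Units
  by (intro group.normal_closure_mono[OF GL_group] E_subgroup elementary_gen_minimal elementary_gen_subset_E)
    (auto simp: GL_simps)

end

section \<open>Splitting\<close>

text \<open>A substitute for the dichotomy in a local ring, where \<open>a\<close> or 1 -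
  \<open>a\<close> is invertible and one summand can be taken to be 1. Stated by explicit equations,
  the property passes to quotient rings.\<close>

locale splitting_ring = ring +
  assumes splitting: "a \<in> carrier R \<Longrightarrow>
    \<exists>d\<^sub>1\<in>carrier R. \<exists>d\<^sub>2\<in>carrier R. \<exists>m\<^sub>1\<in>carrier R. \<exists>m\<^sub>2\<in>carrier R.
      d\<^sub>1 \<oplus> d\<^sub>2 = \<one> \<and> m\<^sub>1 \<otimes> a \<otimes> d\<^sub>1 = d\<^sub>1 \<and> m\<^sub>2 \<otimes> (\<one> \<ominus> a) \<otimes> d\<^sub>2 = d\<^sub>2"

text \<open>The first use of near locality gives f = 1 - b (1 - a) with f a f = f, hence f g = f a
  (f g) for every g. The second, for t = 1 - f = b (1 - a), gives 1 = f g + d with d = -g t d, where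
  t is a left multiple of 1 - a.\<close>

lemma (in nearly_local_ring) splitting_ring: "splitting_ring R"
proof (unfold_locales)
  fix a assume a: "a \<in> carrier R"
  obtain b where b: "b \<in> carrier R" "(\<one> \<oplus> b \<otimes> a) \<otimes> ((\<one> \<ominus> b) \<oplus> a \<otimes> b) = \<zero>"
    using nearly_local[OF a] by blast
  define s t f c where "s = \<one> \<ominus> a" and "t = b \<otimes> s" and "f = \<one> \<ominus> t"
    and "c = (\<one> \<ominus> b) \<oplus> a \<otimes> b"
  have cl: "s \<in> carrier R" "t \<in> carrier R" "f \<in> carrier R" "c \<in> carrier R"
    using a b(1) by (simp_all add: s_def t_def f_def c_def)
  have "s \<otimes> t = t \<ominus> a \<otimes> t"
    using a cl(2) unfolding s_def by algebra
  moreover have "s \<otimes> f = s \<ominus> s \<otimes> t"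
    using cl(1,2) unfolding f_def by algebra
  moreover have "c \<otimes> s = s \<ominus> (t \<ominus> a \<otimes> t)"
    using a b(1) cl(1) unfolding c_def t_def by algebra
  \<comment> \<open>Moving \<open>s\<close> past \<open>c\<close> lets the relation (1 + b a) c = 0
    annihilate s f.\<close>
  ultimately have sf: "s \<otimes> f = c \<otimes> s" by simp
  have "(\<one> \<oplus> b \<otimes> a) \<otimes> (s \<otimes> f) = \<zero>"
    using a b cl unfolding sf by (simp add: c_def m_assoc[symmetric])
  then have 1: "s \<otimes> f \<oplus> b \<otimes> a \<otimes> (s \<otimes> f) = \<zero>"
    using a b(1) cl by (simp add: l_distr)
  have "s \<otimes> a = a \<otimes> s"
    using a unfolding s_def by algebra
  then have 2: "t \<otimes> a \<otimes> f = b \<otimes> a \<otimes> (s \<otimes> f)"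
    using a b(1) cl unfolding t_def by (metis m_assoc m_closed)
  have 3: "a \<otimes> f \<oplus> s \<otimes> f = f"
    using a cl(3) unfolding s_def by algebra
  have "f \<otimes> a \<otimes> f = a \<otimes> f \<ominus> t \<otimes> a \<otimes> f"
    using a cl(2,3) by (subst (1) f_def) algebra
  also have "t \<otimes> a \<otimes> f = \<ominus> (s \<otimes> f)"
    using a b(1) cl 1 2 by (metis m_closed minus_equality a_comm)
  finally have faf: "f \<otimes> a \<otimes> f = f"
    using a cl 3 by (simp add: minus_eq)
  \<comment> \<open>Since t = 1 - f, the second factor is 1 - f g; this is how 1 splits into f g and
    \<open>d\<close>.\<close>
  obtain g where g: "g \<in> carrier R" "(\<one> \<oplus> g \<otimes> t) \<otimes> ((\<one> \<ominus> g) \<oplus> t \<otimes> g) = \<zero>"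
    using nearly_local[OF cl(2)] by blast
  define d where "d = (\<one> \<ominus> g) \<oplus> t \<otimes> g"
  have d: "d \<in> carrier R" using g cl by (simp add: d_def)
  have "f \<otimes> g \<oplus> d = \<one>"
    using cl(2) g(1) unfolding f_def d_def by algebra
  moreover have "f \<otimes> a \<otimes> (f \<otimes> g) = f \<otimes> g"
    using a cl(3) g(1) faf by (metis m_assoc m_closed)
  moreover have "\<ominus> (g \<otimes> b) \<otimes> (\<one> \<ominus> a) \<otimes> d = d"
  proof -
    have "d \<oplus> g \<otimes> t \<otimes> d = \<zero>"
      using g cl d by (simp add: d_def[symmetric] l_distr)
    then have "\<ominus> (g \<otimes> t \<otimes> d) = d"
      using g(1) cl d by (simp add: minus_equality)
    then show ?thesis
      using b(1) g(1) cl d by (simp add: s_def[symmetric] t_def l_minus m_assoc)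
  qed
  ultimately show "\<exists>d\<^sub>1\<in>carrier R. \<exists>d\<^sub>2\<in>carrier R. \<exists>m\<^sub>1\<in>carrier R. \<exists>m\<^sub>2\<in>carrier R.
      d\<^sub>1 \<oplus> d\<^sub>2 = \<one> \<and> m\<^sub>1 \<otimes> a \<otimes> d\<^sub>1 = d\<^sub>1 \<and> m\<^sub>2 \<otimes> (\<one> \<ominus> a) \<otimes> d\<^sub>2 = d\<^sub>2"
    using a b(1) g(1) cl(3) d
    by (intro bexI[of _ "f \<otimes> g"] bexI[of _ d] bexI[of _ f] bexI[of _ "\<ominus> (g \<otimes> b)"] conjI) auto
qed

section \<open>Unipotent matrices\<close>

text \<open>Both squares and Y P vanish, so P Y is the only mixed term that survives. This is the
  device for writing 1 + P Y as a commutator.\<close>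

lemma (in ring) unipotent_commutator:
  assumes "P \<in> carrier R" "Y \<in> carrier R" "P \<otimes> P = \<zero>" "Y \<otimes> Y = \<zero>" "Y \<otimes> P = \<zero>"
  shows "(\<one> \<oplus> P) \<otimes> (\<one> \<oplus> Y) \<otimes> (\<one> \<ominus> P) \<otimes> (\<one> \<ominus> Y) = \<one> \<oplus> P \<otimes> Y"
proof -
  have "(\<one> \<oplus> P) \<otimes> (\<one> \<oplus> Y) \<otimes> (\<one> \<ominus> P) = \<one> \<oplus> Y \<oplus> P \<otimes> Y \<ominus> P \<otimes> P \<ominus> Y \<otimes> P \<ominus> P \<otimes> (Y \<otimes> P)"
    using assms(1,2) by algebra
  also have "\<dots> = \<one> \<oplus> Y \<oplus> P \<otimes> Y"
    using assms by (simp add: minus_eq)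
  also have "\<dots> \<otimes> (\<one> \<ominus> Y) = \<one> \<oplus> P \<otimes> Y \<ominus> Y \<otimes> Y \<ominus> P \<otimes> (Y \<otimes> Y)"
    using assms(1,2) by algebra
  also have "\<dots> = \<one> \<oplus> P \<otimes> Y"
    using assms by (simp add: minus_eq)
  finally show ?thesis .
qed

section \<open>Matrices over an ideal, and elementary matrices supported in one row or
  column\<close>

context matrix_ring
begin

definition mats :: "'a set \<Rightarrow> 'a mat set" where
  "mats I = {A \<in> carrier M. \<forall>i<n. \<forall>j<n. A $$ (i, j) \<in> I}"

lemma mats_closed: "A \<in> mats I \<Longrightarrow> A \<in> carrier M"
  by (simp add: mats_def)

lemma mats_entry: "A \<in> mats I \<Longrightarrow> i < n \<Longrightarrow> j < n \<Longrightarrow> A $$ (i, j) \<in> I"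
  by (simp add: mats_def)

lemma mats_carrier: "mats (carrier R) = carrier M"
  by (auto simp: mats_def)

lemma finsum_in_ideal:
  assumes "ideal I R" "finite A" "\<And>k. k \<in> A \<Longrightarrow> f k \<in> I"
  shows "(\<Oplus>k\<in>A. f k) \<in> I"
  using assms(2,3)
proof (induction A rule: finite_induct)
  case empty
  then show ?case using assms(1) by (simp add: additive_subgroup.zero_closed ideal.axioms(1))
next
  case (insert a A)
  interpret I: ideal I R by fact
  have "(\<Oplus>k\<in>insert a A. f k) = f a \<oplus> (\<Oplus>k\<in>A. f k)"
    using insert by (intro finsum_insert) (auto intro: I.a_Hcarr)
  then show ?case using insert by simp
qed

lemma mats_ideal:
  assumes "ideal I R"
  shows "ideal (mats I) M"
proof -
  interpret I: ideal I R by fact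
  show ?thesis
  proof (rule idealI[OF ring_M])
    show "subgroup (mats I) (add_monoid M)"
    proof (rule group.subgroupI[OF M.a_group])
      have "\<^bold>0 \<in> mats I" by (simp add: mats_def)
      then show "mats I \<noteq> {}" by blast
    next
      fix A assume A: "A \<in> mats I"
      then have "\<ominus>\<^bsub>M\<^esub> A \<in> mats I" by (simp add: mats_def)
      then show "inv\<^bsub>add_monoid M\<^esub> A \<in> mats I" by (simp add: a_inv_def)
    qed (auto simp: mats_def)
  next
    fix A B assume A: "A \<in> mats I" and B: "B \<in> carrier M"
    show "B \<cdot> A \<in> mats I" "A \<cdot> B \<in> mats I"
      using A B unfolding mats_def
      by (auto simp: entry_mult intro!: finsum_in_ideal[OF assms] intro: I.I_l_closed I.I_r_closed)
  qed
qed

lemma U_in_mats: "ideal I R \<Longrightarrow> x \<in> I \<Longrightarrow> U i j x \<in> mats I"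
  using ideal.Icarr[of I R x]
  by (auto simp: mats_def additive_subgroup.zero_closed[OF ideal.axioms(1)])

text \<open>The condition on \<open>F\<close> makes the transvections at the positions in \<open>F\<close> commute.\<close>

lemma unipotent_in_elementary_gen:
  assumes I: "I \<subseteq> carrier R"
    and "finite F" "F \<subseteq> {..<n} \<times> {..<n}"
    and "\<And>a b c d. (a, b) \<in> F \<Longrightarrow> (c, d) \<in> F \<Longrightarrow> b \<noteq> c"
    and "Z \<in> carrier M" "\<And>i j. (i, j) \<in> F \<Longrightarrow> Z $$ (i, j) \<in> I"
    and "\<And>i j. i < n \<Longrightarrow> j < n \<Longrightarrow> (i, j) \<notin> F \<Longrightarrow> Z $$ (i, j) = \<zero>"
  shows "\<^bold>1 \<^bold>+ Z \<in> elementary_gen n R I"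
  using assms(2-)
proof (induction F arbitrary: Z rule: finite_induct)
  case empty
  have "Z = \<^bold>0" using empty by (intro mat_eqI) auto
  then show ?case
    using GL_subgroupD(2)[OF elementary_gen_subgroup[OF I]] by simp
next
  case (insert p F)
  obtain a b where p: "p = (a, b)" by fastforce
  have ab: "a < n" "b < n" "a \<noteq> b" "Z $$ (a, b) \<in> I"
    using insert.prems(1) insert.prems(2)[of a b a b] insert.prems(4)[of a b] p by auto
  define z where "z = Z $$ (a, b)"
  have z: "z \<in> carrier R" "z \<in> I" using ab insert.prems(3) by (auto simp: z_def)
  define Z' where "Z' = Z \<^bold>- U a b z"
  have Z': "Z' \<in> carrier M" using insert.prems(3) z by (simp add: Z'_def)
  have ent: "Z' $$ (i, j) = (if (i, j) = (a, b) then \<zero> else Z $$ (i, j))" if "i < n" "j < n" for i j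
    using that insert.prems(3) z by (auto simp: Z'_def z_def minus_eq r_neg)
  have "\<^bold>1 \<^bold>+ Z' \<in> elementary_gen n R I"
  proof (rule insert.IH)
    show "F \<subseteq> {..<n} \<times> {..<n}" using insert.prems(1) by auto
    show "q \<noteq> c" if "(r, q) \<in> F" "(c, d) \<in> F" for r q c d
      using insert.prems(2) that by blast
    show "Z' \<in> carrier M" by fact
    show "Z' $$ (i, j) \<in> I" if "(i, j) \<in> F" for i j
      using that insert.prems(1,4) insert.hyps p ent[of i j] by auto
    show "Z' $$ (i, j) = \<zero>" if "i < n" "j < n" "(i, j) \<notin> F" for i j
      using that insert.prems(5) p ent[of i j] by auto
  qed
  moreover have "\<^bold>1 \<^bold>+ U a b z \<in> elementary_gen n R I"
    using ab z by (intro transvection_in_elementary_gen) auto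
  ultimately have "(\<^bold>1 \<^bold>+ Z') \<cdot> (\<^bold>1 \<^bold>+ U a b z) \<in> elementary_gen n R I"
    using GL_subgroupD(3)[OF elementary_gen_subgroup[OF I]] by blast
  \<comment> \<open>The product sees only column \<open>a\<close> of \<open>Z'\<close>, which is
    zero because a position (i, a) cannot occur together with (a, b).\<close>
  moreover have "Z' \<cdot> U a b z = \<^bold>0"
  proof (rule mat_eqI)
    fix i j assume ij: "i < n" "j < n"
    have "Z' $$ (i, a) = \<zero>"
      using ij ab ent[of i a] insert.prems(2)[of i a a b] insert.prems(5)[of i a] p by auto
    then show "(Z' \<cdot> U a b z) $$ (i, j) = \<^bold>0 $$ (i, j)"
      using ij ab z Z' by simp
  qed (use Z' z in auto)
  moreover have "(\<^bold>1 \<^bold>+ Z') \<cdot> (\<^bold>1 \<^bold>+ U a b z) = \<^bold>1 \<^bold>+ Z \<^bold>+ Z' \<cdot> U a b z"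
    using insert.prems(3) z U_closed[OF z(1), of a b] unfolding Z'_def by algebra
  ultimately show ?case using insert.prems(3) by simp
qed

text \<open>The idempotent e_kk: on the left it cuts out row \<open>k\<close>, on the right column
  \<open>k\<close>. Supports of matrices are described by such equations.\<close>

abbreviation e :: "nat \<Rightarrow> 'a mat" where "e k \<equiv> U k k \<one>"

lemma e_closed: "e k \<in> carrier M" by simp

text \<open>The equations place \<open>Z\<close> in row \<open>k\<close> off the diagonal. There no
  column index equals a row index, as the expansion into transvections requires.\<close>

lemma row_unipotent:
  assumes "I \<subseteq> carrier R" "k < n" "Z \<in> mats I" "e k \<cdot> Z = Z" "Z \<cdot> e k = \<^bold>0"
  shows "\<^bold>1 \<^bold>+ Z \<in> elementary_gen n R I"
proof (rule unipotent_in_elementary_gen[where F = "{k} \<times> ({..<n} - {k})"])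
  have Z: "Z \<in> carrier M" using assms(3) by (rule mats_closed)
  fix i j assume ij: "i < n" "j < n" "(i, j) \<notin> {k} \<times> ({..<n} - {k})"
  show "Z $$ (i, j) = \<zero>"
  proof (cases "i = k")
    case True
    then have "j = k" using ij by auto
    moreover have "(Z \<cdot> e k) $$ (i, k) = \<^bold>0 $$ (i, k)" using assms(5) by simp
    ultimately show ?thesis using ij assms(2) Z by simp
  next
    case False
    have "(e k \<cdot> Z) $$ (i, j) = Z $$ (i, j)" using assms(4) by simp
    then show ?thesis using ij assms(2) Z False by simp
  qed
next
  show "Z $$ (i, j) \<in> I" if "(i, j) \<in> {k} \<times> ({..<n} - {k})" for i j
    using that assms(2) by (intro mats_entry[OF assms(3)]) auto
qed (use assms(1,2) mats_closed[OF assms(3)] in auto)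

lemma col_unipotent:
  assumes "I \<subseteq> carrier R" "k < n" "Z \<in> mats I" "Z \<cdot> e k = Z" "e k \<cdot> Z = \<^bold>0"
  shows "\<^bold>1 \<^bold>+ Z \<in> elementary_gen n R I"
proof (rule unipotent_in_elementary_gen[where F = "({..<n} - {k}) \<times> {k}"])
  have Z: "Z \<in> carrier M" using assms(3) by (rule mats_closed)
  fix i j assume ij: "i < n" "j < n" "(i, j) \<notin> ({..<n} - {k}) \<times> {k}"
  show "Z $$ (i, j) = \<zero>"
  proof (cases "j = k")
    case True
    then have "i = k" using ij by auto
    moreover have "(e k \<cdot> Z) $$ (k, j) = \<^bold>0 $$ (k, j)" using assms(5) by simp
    ultimately show ?thesis using ij assms(2) Z by simp
  next
    case False
    have "(Z \<cdot> e k) $$ (i, j) = Z $$ (i, j)" using assms(4) by simp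
    then show ?thesis using ij assms(2) Z False by simp
  qed
next
  show "Z $$ (i, j) \<in> I" if "(i, j) \<in> ({..<n} - {k}) \<times> {k}" for i j
    using that assms(2) by (intro mats_entry[OF assms(3)]) auto
qed (use assms(1,2) mats_closed[OF assms(3)] in auto)

end

text \<open>Split Q into Q (1 - e) and Q e. The first part contributes P Y, and 1 + P Y is the
  commutator of 1 + P and 1 + Y because Y P = 0; the second contributes Z, with Z P = 0. For e =
  e_kk, P and Z live in column k and Y in row k, all off the diagonal, so every factor is
  elementary.\<close>

lemma (in ring) base_identities:
  assumes cl: "e \<in> carrier R" "P \<in> carrier R" "X \<in> carrier R" "Q \<in> carrier R"
    and rel: "e \<otimes> e = e" "P \<otimes> e = P" "e \<otimes> P = \<zero>" "e \<otimes> X = X" "Q \<otimes> P = \<zero>"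
    and Y: "Y = X \<otimes> Q \<otimes> (\<one> \<ominus> e)" and Z: "Z = P \<otimes> X \<otimes> Q \<otimes> e"
  shows "e \<otimes> Y = Y" "Y \<otimes> e = \<zero>" "Z \<otimes> e = Z" "e \<otimes> Z = \<zero>"
    and "\<one> \<oplus> P \<otimes> X \<otimes> Q = (\<one> \<oplus> Z) \<otimes> ((\<one> \<oplus> P) \<otimes> (\<one> \<oplus> Y) \<otimes> (\<one> \<ominus> P) \<otimes> (\<one> \<ominus> Y))"
proof -
  have clYZ: "Y \<in> carrier R" "Z \<in> carrier R" using cl by (simp_all add: Y Z)
  show eY: "e \<otimes> Y = Y"
    using cl rel(4) unfolding Y by (simp add: m_assoc[symmetric])
  have "(\<one> \<ominus> e) \<otimes> e = \<zero>"
    using cl(1) rel(1) by (simp add: minus_eq l_distr l_minus r_neg)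
  then show Ye: "Y \<otimes> e = \<zero>"
    using cl unfolding Y by (simp add: m_assoc)
  show "Z \<otimes> e = Z"
    using cl rel(1) unfolding Z by (simp add: m_assoc)
  show "e \<otimes> Z = \<zero>"
    using cl rel(3) unfolding Z by (simp add: m_assoc[symmetric])
  have PP: "P \<otimes> P = \<zero>"
    using cl rel(2,3) by (metis m_assoc r_null)
  have YY: "Y \<otimes> Y = \<zero>"
    using cl(1) clYZ eY Ye by (metis m_assoc l_null)
  have "(\<one> \<ominus> e) \<otimes> P = P"
    using cl rel(3) by (simp add: minus_eq l_distr l_minus)
  then have YP: "Y \<otimes> P = \<zero>"
    using cl rel(5) unfolding Y by (simp add: m_assoc)
  have ZP: "Z \<otimes> P = \<zero>"
    using cl rel(3) unfolding Z by (simp add: m_assoc)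
  have "(\<one> \<oplus> Z) \<otimes> (\<one> \<oplus> P \<otimes> Y) = \<one> \<oplus> (P \<otimes> Y \<oplus> Z) \<oplus> (Z \<otimes> P) \<otimes> Y"
    using cl clYZ by algebra
  moreover have "P \<otimes> Y \<oplus> Z = P \<otimes> X \<otimes> Q"
  proof -
    have "P \<otimes> Y = P \<otimes> X \<otimes> Q \<otimes> (\<one> \<ominus> e)"
      using cl unfolding Y by (simp add: m_assoc)
    moreover have "A \<otimes> (\<one> \<ominus> e) \<oplus> A \<otimes> e = A" if "A \<in> carrier R" for A
      using that cl(1) by algebra
    ultimately show ?thesis using cl unfolding Z by simp
  qed
  ultimately show "\<one> \<oplus> P \<otimes> X \<otimes> Q = (\<one> \<oplus> Z) \<otimes> ((\<one> \<oplus> P) \<otimes> (\<one> \<oplus> Y) \<otimes> (\<one> \<ominus> P) \<otimes> (\<one> \<ominus> Y))"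
    using cl clYZ ZP unipotent_commutator[OF cl(2) clYZ(1) PP YY YP] by simp
qed

lemma (in ring) conj_one_plus:
  assumes "h \<in> Units R" "X \<in> carrier R"
  shows "h \<otimes> (\<one> \<oplus> X) \<otimes> inv h = \<one> \<oplus> h \<otimes> X \<otimes> inv h"
  using assms by (simp add: r_distr l_distr Units_closed)

section \<open>Conjugates of transvections along a column with a zero coordinate\<close>

context matrix_ring
begin

abbreviation EI where "EI I \<equiv> elementary_ideal n R I"

lemma minv_cancel:
  assumes "g \<in> Units M" "A \<in> carrier M"
  shows "minv g \<cdot> (g \<cdot> A) = A" "g \<cdot> (minv g \<cdot> A) = A"
  using assms by (simp_all add: M.m_assoc[symmetric] M.Units_closed)

lemma U_mult_U_left:
  assumes "r \<in> carrier R" "s \<in> carrier R" "j < n" "k < n" "A \<in> carrier M"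
  shows "U i j r \<cdot> (U k l s \<cdot> A) = (if j = k then U i l (r \<otimes> s) \<cdot> A else \<^bold>0)"
  using assms by (simp add: M.m_assoc[symmetric] U_mult_U)

lemma U_sandwich':
  assumes "A \<in> carrier M" "r \<in> carrier R" "s \<in> carrier R" "j < n" "k < n"
  shows "U i j r \<cdot> (A \<cdot> U k l s) = U i l (r \<otimes> A $$ (j, k) \<otimes> s)"
  using assms by (simp add: M.m_assoc[symmetric] U_sandwich)

lemma U_sandwich_left:
  assumes "A \<in> carrier M" "B \<in> carrier M" "r \<in> carrier R" "s \<in> carrier R" "j < n" "k < n"
  shows "U i j r \<cdot> (A \<cdot> (U k l s \<cdot> B)) = U i l (r \<otimes> A $$ (j, k) \<otimes> s) \<cdot> B"
  using assms by (simp add: M.m_assoc[symmetric] U_sandwich)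

text \<open>Products are nested to the right, hence the rules with a trailing factor. Together they
  evaluate words in matrix units and cancel inverse pairs.\<close>

lemmas mat_simps = M.m_assoc U_mult_U U_mult_U_left U_sandwich' U_sandwich_left minv_cancel M.Units_closed

lemma elementary_ideal_closed:
  assumes "ideal I R"
  shows "\<^bold>1 \<in> EI I"
    and "x \<in> EI I \<Longrightarrow> y \<in> EI I \<Longrightarrow> x \<cdot> y \<in> EI I"
    and "x \<in> EI I \<Longrightarrow> minv x \<in> EI I"
    and "x \<in> EI I \<Longrightarrow> x \<in> Units M"
    and "x \<in> elementary_gen n R I \<Longrightarrow> x \<in> EI I"
    and "h \<in> E \<Longrightarrow> x \<in> EI I \<Longrightarrow> h \<cdot> x \<cdot> minv h \<in> EI I"
proof -
  have "I \<subseteq> carrier R" using ideal.Icarr[OF assms] by blast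
  note * = elementary_ideal[OF this]
  note ** = GL_subgroupD[OF *(1)]
  show "\<^bold>1 \<in> EI I"
    and "x \<in> EI I \<Longrightarrow> y \<in> EI I \<Longrightarrow> x \<cdot> y \<in> EI I"
    and "x \<in> EI I \<Longrightarrow> minv x \<in> EI I"
    and "x \<in> EI I \<Longrightarrow> x \<in> Units M"
    and "x \<in> elementary_gen n R I \<Longrightarrow> x \<in> EI I"
    and "h \<in> E \<Longrightarrow> x \<in> EI I \<Longrightarrow> h \<cdot> x \<cdot> minv h \<in> EI I"
    using ** *(3,4) by blast+
qed

lemma E_closed:
  "\<^bold>1 \<in> E" "x \<in> E \<Longrightarrow> y \<in> E \<Longrightarrow> x \<cdot> y \<in> E" "x \<in> E \<Longrightarrow> minv x \<in> E" "x \<in> E \<Longrightarrow> x \<in> Units M"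
  using GL_subgroupD[OF E_subgroup] by blast+

lemma unconj_elementary_ideal:
  assumes "ideal I R" "h \<in> E" "A \<in> carrier M" "h \<cdot> A \<cdot> minv h \<in> EI I"
  shows "A \<in> EI I"
proof -
  have h: "h \<in> Units M" using assms(2) by (rule E_closed)
  have "minv h \<cdot> (h \<cdot> A \<cdot> minv h) \<cdot> minv (minv h) \<in> EI I"
    by (rule elementary_ideal_closed(6)[OF assms(1) E_closed(3)[OF assms(2)] assms(4)])
  moreover have "minv h \<cdot> (h \<cdot> A \<cdot> minv h) \<cdot> minv (minv h) = A"
    using h assms(3) by (simp add: mat_simps)
  ultimately show ?thesis by simp
qed

text \<open>With u the column \<open>k\<close> of \<open>P\<close> and v the row \<open>k\<close> of
  \<open>Q\<close>, the matrix is 1 + u x v, where v u = 0 and u_k = 0. In the factorization of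
  \<open>base_identities\<close>, \<open>Y\<close> and \<open>Z\<close> have entries in
  \<open>I\<close>, while 1 + \<open>P\<close> need only lie in \<open>E\<close>: the commutator is
  a conjugate of 1 + \<open>Y\<close> times the inverse of 1 + \<open>Y\<close>.\<close>

lemma elementary_ideal_zero_row:
  assumes I: "ideal I R" and k: "k < n" and x: "x \<in> I"
    and P: "P \<in> carrier M" "P \<cdot> e k = P" "e k \<cdot> P = \<^bold>0"
    and Q: "Q \<in> carrier M" "Q \<cdot> P = \<^bold>0"
  shows "\<^bold>1 \<^bold>+ P \<cdot> U k k x \<cdot> Q \<in> EI I"
proof -
  interpret I: ideal I R by fact
  interpret J: ideal "mats I" M by (rule mats_ideal[OF I])
  define Y where "Y = U k k x \<cdot> Q \<cdot> (\<^bold>1 \<^bold>- e k)"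
  define Z where "Z = P \<cdot> U k k x \<cdot> Q \<cdot> e k"
  have xR: "x \<in> carrier R" using x by (rule I.a_Hcarr)
  have X: "U k k x \<in> mats I" using I x by (rule U_in_mats)
  have YZ: "Y \<in> mats I" "Z \<in> mats I"
    unfolding Y_def Z_def using X P(1) Q(1) by (intro J.I_l_closed J.I_r_closed; simp)+
  have IR: "I \<subseteq> carrier R" using I.a_Hcarr by blast
  note ids = M.base_identities[OF e_closed P(1) U_closed[OF xR] Q(1) _ P(2,3) _ Q(2) Y_def Z_def]
  have ee: "e k \<cdot> e k = e k" "e k \<cdot> U k k x = U k k x"
    using k xR by (simp_all add: U_mult_U)
  note ids = ids[OF ee]
  have 1: "\<^bold>1 \<^bold>+ Y \<in> EI I"
    using ids k YZ by (intro elementary_ideal_closed(5)[OF I] row_unipotent IR)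
  have 2: "\<^bold>1 \<^bold>+ Z \<in> EI I"
    using ids k YZ by (intro elementary_ideal_closed(5)[OF I] col_unipotent IR)
  have 3: "\<^bold>1 \<^bold>+ P \<in> E"
    unfolding elementary_group_def
    using P k by (intro col_unipotent[where k = k]) (simp_all add: mats_carrier)
  have PP: "P \<cdot> P = \<^bold>0" using P by (metis M.m_assoc M.r_null e_closed)
  have YY: "Y \<cdot> Y = \<^bold>0"
    using ids(1,2) YZ(1)[THEN mats_closed] by (metis M.m_assoc M.l_null e_closed)
  have "(\<^bold>1 \<^bold>+ P) \<cdot> (\<^bold>1 \<^bold>+ Y) \<cdot> (\<^bold>1 \<^bold>- P) \<in> EI I"
    using elementary_ideal_closed(6)[OF I 3 1] M.one_plus_square_zero(2)[OF P(1) PP] by simp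
  moreover have "\<^bold>1 \<^bold>- Y \<in> EI I"
    using elementary_ideal_closed(3)[OF I 1] M.one_plus_square_zero(2)[OF YZ(1)[THEN mats_closed] YY] by simp
  ultimately show ?thesis
    using 2 elementary_ideal_closed(2)[OF I] unfolding ids(5) by simp
qed

text \<open>E(n,I) is stable under conjugation by \<open>E\<close>, so the conjugate by
  \<open>h\<close> may be treated instead, and for it the coordinate \<open>k\<close> of the
  relevant column is zero.\<close>

lemma elementary_ideal_reduced_column:
  assumes I: "ideal I R" and g: "g \<in> Units M" and ij: "i < n" "j < n" "i \<noteq> j" and k: "k < n"
    and d: "d \<in> carrier R" and x: "x \<in> I" and h: "h \<in> E"
    and z: "e k \<cdot> (h \<cdot> (g \<cdot> U i i d)) = \<^bold>0"
  shows "\<^bold>1 \<^bold>+ g \<cdot> U i j (d \<otimes> x) \<cdot> minv g \<in> EI I"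
proof -
  interpret I: ideal I R by fact
  have xR: "x \<in> carrier R" using x by (rule I.a_Hcarr)
  have hU: "h \<in> Units M" using h by (rule E_closed)
  note cl = hU g d xR M.Units_closed[OF hU] M.Units_closed[OF g] M.Units_inv_closed[OF hU] M.Units_inv_closed[OF g]
  \<comment> \<open>\<open>P\<close> is column \<open>i\<close> of h g, times \<open>d\<close>,
    moved to column \<open>k\<close>; \<open>Q\<close> is row \<open>j\<close> of the inverse of h
    g, moved to row \<open>k\<close>. Since \<open>i \<noteq> j\<close>, the product
    \<open>Q \<cdot> P\<close> vanishes.\<close>
  define P where "P = h \<cdot> g \<cdot> U i k d"
  define Q where "Q = U k j \<one> \<cdot> minv g \<cdot> minv h"
  have "P = h \<cdot> (g \<cdot> U i i d) \<cdot> U i k \<one>"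
    using cl ij k unfolding P_def by (simp add: mat_simps)
  then have "e k \<cdot> P = e k \<cdot> (h \<cdot> (g \<cdot> U i i d)) \<cdot> U i k \<one>"
    using cl by (simp add: M.m_assoc)
  then have "e k \<cdot> P = \<^bold>0" unfolding z by simp
  moreover have "P \<cdot> e k = P"
    using cl ij k unfolding P_def by (simp add: mat_simps)
  moreover have "Q \<cdot> P = \<^bold>0"
    using cl ij k unfolding P_def Q_def by (simp add: mat_simps)
  ultimately have "\<^bold>1 \<^bold>+ P \<cdot> U k k x \<cdot> Q \<in> EI I"
    using cl by (intro elementary_ideal_zero_row[OF I k x]) (simp_all add: P_def Q_def)
  moreover have "P \<cdot> U k k x \<cdot> Q = h \<cdot> (g \<cdot> U i j (d \<otimes> x) \<cdot> minv g) \<cdot> minv h"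
    using cl ij k unfolding P_def Q_def by (simp add: mat_simps)
  ultimately have *: "h \<cdot> (\<^bold>1 \<^bold>+ g \<cdot> U i j (d \<otimes> x) \<cdot> minv g) \<cdot> minv h \<in> EI I"
    using cl by (simp add: M.conj_one_plus)
  show ?thesis
    by (rule unconj_elementary_ideal[OF I h _ *]) (simp add: cl)
qed

end

section \<open>Conjugates of transvections by arbitrary invertible matrices\<close>

locale splitting_matrix_ring = matrix_ring R n + splitting_ring R
  for R (structure) and n :: nat
begin

lemma conj_transvection_in_elementary_ideal:
  assumes I: "ideal I R" and g: "g \<in> Units M" and ij: "i < n" "j < n" "i \<noteq> j" and x: "x \<in> I"
  shows "g \<cdot> (\<^bold>1 \<^bold>+ U i j x) \<cdot> minv g \<in> EI I"
proof -
  interpret I: ideal I R by fact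
  define W where "W = minv g"
  have xR: "x \<in> carrier R" using x by (rule I.a_Hcarr)
  have cl: "g \<in> carrier M" "W \<in> carrier M" using g by (auto simp: W_def)
  \<comment> \<open>One summand of row \<open>i\<close> of \<open>W\<close> times column
    \<open>i\<close> of \<open>g\<close>, which is 1; so 1 - \<open>a\<close> is the sum of the
    others.\<close>
  define a where "a = W $$ (i, i) \<otimes> g $$ (i, i)"
  have a: "a \<in> carrier R" using cl ij by (simp add: a_def)
  obtain d1 d2 m1 m2 where d: "d1 \<in> carrier R" "d2 \<in> carrier R" "m1 \<in> carrier R" "m2 \<in> carrier R"
    "d1 \<oplus> d2 = \<one>" "m1 \<otimes> a \<otimes> d1 = d1" "m2 \<otimes> (\<one> \<ominus> a) \<otimes> d2 = d2"
    using splitting[OF a] by blast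
  have gc: "g $$ (j, i) \<in> carrier R" "g $$ (i, i) \<in> carrier R" "W $$ (i, i) \<in> carrier R"
    using cl ij by auto
  have 1: "\<^bold>1 \<^bold>+ g \<cdot> U i j (d1 \<otimes> x) \<cdot> minv g \<in> EI I"
  proof (rule elementary_ideal_reduced_column[OF I g ij ij(2) d(1) x])
    \<comment> \<open>Here s g_ii d1 = g_ji (m1 a d1) = g_ji d1, so subtracting \<open>s\<close>
      times row \<open>i\<close> clears coordinate \<open>j\<close>.\<close>
    define s where "s = g $$ (j, i) \<otimes> m1 \<otimes> W $$ (i, i)"
    have s: "s \<in> carrier R" using gc d by (simp add: s_def)
    show "\<^bold>1 \<^bold>+ U j i (\<ominus> s) \<in> E"
      using ij s by (intro transvection_in_E) auto
    have "U j i (\<ominus> s) \<cdot> (g \<cdot> U i i d1) = U j i (\<ominus> (s \<otimes> g $$ (i, i) \<otimes> d1))"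
      using cl ij s d gc by (simp add: U_sandwich' l_minus)
    also have "s \<otimes> g $$ (i, i) \<otimes> d1 = g $$ (j, i) \<otimes> d1"
    proof -
      have "s \<otimes> g $$ (i, i) \<otimes> d1 = g $$ (j, i) \<otimes> (m1 \<otimes> a \<otimes> d1)"
        using d(1-4) gc by (simp add: s_def a_def m_assoc)
      then show ?thesis using d(6) by simp
    qed
    finally have "(\<^bold>1 \<^bold>+ U j i (\<ominus> s)) \<cdot> (g \<cdot> U i i d1) = g \<cdot> U i i d1 \<^bold>- U j i (g $$ (j, i) \<otimes> d1)"
      using cl d gc s by (simp add: M.l_distr U_uminus M.minus_eq)
    then show "e j \<cdot> ((\<^bold>1 \<^bold>+ U j i (\<ominus> s)) \<cdot> (g \<cdot> U i i d1)) = \<^bold>0"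
      using cl d gc ij by (simp add: M.minus_eq M.r_distr M.r_minus U_sandwich' U_mult_U M.r_neg)
  qed
  have 2: "\<^bold>1 \<^bold>+ g \<cdot> U i j (d2 \<otimes> x) \<cdot> minv g \<in> EI I"
  proof (rule elementary_ideal_reduced_column[OF I g ij ij(1) d(2) x])
    define s where "s = g $$ (i, i) \<otimes> m2"
    have s: "s \<in> carrier R" using gc d by (simp add: s_def)
    \<comment> \<open>Since 1 - a is the sum of W_ik g_ki over k \<noteq> i, this row operation
      subtracts g_ii m2 (1 - a) d2 = g_ii d2 from coordinate \<open>i\<close>. The last factor
      removes the diagonal entry.\<close>
    define V where "V = U i i (\<ominus> s) \<cdot> W \<cdot> (\<^bold>1 \<^bold>- e i)"
    have V: "V \<in> carrier M" using s cl by (simp add: V_def)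
    show "\<^bold>1 \<^bold>+ V \<in> E"
      unfolding elementary_group_def
    proof (rule row_unipotent[where k = i])
      show "e i \<cdot> V = V" using s cl ij by (simp add: V_def mat_simps)
      show "V \<cdot> e i = \<^bold>0"
        using s cl ij by (simp add: V_def M.m_assoc M.minus_eq M.l_distr M.l_minus U_mult_U M.r_neg)
    qed (use ij V in \<open>auto simp: mats_carrier\<close>)
    have "V \<cdot> (g \<cdot> U i i d2) = U i i (\<ominus> s) \<cdot> (W \<cdot> (g \<cdot> U i i d2)) \<^bold>-
        U i i (\<ominus> s) \<cdot> (W \<cdot> (e i \<cdot> (g \<cdot> U i i d2)))"
      using s cl d unfolding V_def
      by (simp add: M.m_assoc M.minus_eq M.l_distr M.r_distr M.l_minus M.r_minus)
    also have "W \<cdot> (g \<cdot> U i i d2) = U i i d2"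
      using g d by (simp add: W_def minv_cancel)
    also have "U i i (\<ominus> s) \<cdot> U i i d2 = U i i (\<ominus> s \<otimes> d2)"
      using s d ij by (simp add: U_mult_U)
    also have "e i \<cdot> (g \<cdot> U i i d2) = U i i (g $$ (i, i) \<otimes> d2)"
      using cl d gc ij by (simp add: U_sandwich')
    also have "U i i (\<ominus> s) \<cdot> (W \<cdot> U i i (g $$ (i, i) \<otimes> d2)) = U i i (\<ominus> s \<otimes> (a \<otimes> d2))"
      using s cl d gc ij by (simp add: U_sandwich' a_def m_assoc)
    also have "U i i (\<ominus> s \<otimes> d2) \<^bold>- U i i (\<ominus> s \<otimes> (a \<otimes> d2)) = U i i (\<ominus> s \<otimes> d2 \<ominus> \<ominus> s \<otimes> (a \<otimes> d2))"
      using s d a by (simp add: minus_eq M.minus_eq U_add U_uminus)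
    also have "\<ominus> s \<otimes> d2 \<ominus> \<ominus> s \<otimes> (a \<otimes> d2) = \<ominus> (s \<otimes> ((\<one> \<ominus> a) \<otimes> d2))"
      using s d(2) a by algebra
    also have "s \<otimes> ((\<one> \<ominus> a) \<otimes> d2) = g $$ (i, i) \<otimes> d2"
      using d gc a by (simp add: s_def m_assoc)
    finally show "e i \<cdot> ((\<^bold>1 \<^bold>+ V) \<cdot> (g \<cdot> U i i d2)) = \<^bold>0"
      using cl d gc V ij by (simp add: M.l_distr M.r_distr U_sandwich' U_mult_U U_uminus M.r_minus M.r_neg)
  qed
  have "(\<^bold>1 \<^bold>+ U i j (d1 \<otimes> x)) \<cdot> (\<^bold>1 \<^bold>+ U i j (d2 \<otimes> x)) = \<^bold>1 \<^bold>+ U i j x"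
  proof -
    have "(\<^bold>1 \<^bold>+ U i j (d1 \<otimes> x)) \<cdot> (\<^bold>1 \<^bold>+ U i j (d2 \<otimes> x)) =
        \<^bold>1 \<^bold>+ (U i j (d1 \<otimes> x) \<^bold>+ U i j (d2 \<otimes> x)) \<^bold>+ U i j (d1 \<otimes> x) \<cdot> U i j (d2 \<otimes> x)"
      using d xR by (simp add: M.l_distr M.r_distr M.a_ac)
    also have "U i j (d1 \<otimes> x) \<^bold>+ U i j (d2 \<otimes> x) = U i j x"
      using d xR by (simp add: U_add[symmetric] l_distr[symmetric])
    finally show ?thesis
      using d xR ij by (simp add: U_mult_U)
  qed
  moreover have "g \<cdot> (A \<cdot> B) \<cdot> minv g = (g \<cdot> A \<cdot> minv g) \<cdot> (g \<cdot> B \<cdot> minv g)"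
    if "A \<in> carrier M" "B \<in> carrier M" for A B
    using that g by (simp add: mat_simps)
  moreover have "g \<cdot> (\<^bold>1 \<^bold>+ U i j (d \<otimes> x)) \<cdot> minv g \<in> EI I"
    if "\<^bold>1 \<^bold>+ g \<cdot> U i j (d \<otimes> x) \<cdot> minv g \<in> EI I" "d \<in> carrier R" for d
    using that g xR by (simp add: M.conj_one_plus)
  ultimately show ?thesis
    using 1 2 d xR elementary_ideal_closed(2)[OF I]
    by (metis M.add.m_closed M_closed(1) U_closed m_closed)
qed

end

section \<open>Reduction modulo an ideal\<close>

lemma (in ring) minus_eq_zero_iff:
  assumes "x \<in> carrier R" "y \<in> carrier R"
  shows "x \<ominus> y = \<zero> \<longleftrightarrow> x = y"
  using assms by (metis minus_eq r_neg minus_equality minus_minus a_inv_closed a_comm)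

lemma (in ring_hom_ring) hom_finsum_ring:
  assumes "finite A" "\<And>a. a \<in> A \<Longrightarrow> f a \<in> carrier R"
  shows "h (finsum R f A) = finsum S (\<lambda>a. h (f a)) A"
  using assms
proof (induction A rule: finite_induct)
  case empty
  then show ?case by simp
next
  case (insert a A)
  then have "finsum R f (insert a A) = f a \<oplus>\<^bsub>R\<^esub> finsum R f A"
    by (intro R.finsum_insert) auto
  moreover have "finsum S (\<lambda>a. h (f a)) (insert a A) = h (f a) \<oplus>\<^bsub>S\<^esub> finsum S (\<lambda>a. h (f a)) A"
    using insert by (intro S.finsum_insert) auto
  ultimately show ?case using insert by (auto intro!: R.finsum_closed)
qed

lemma map_mat_ring_hom:
  assumes "ring_hom_ring R S h"
  shows "ring_hom_ring (mat_ring n R) (mat_ring n S) (map_mat h)"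
proof -
  interpret h: ring_hom_ring R S h by fact
  have R: "matrix_ring R" and S: "matrix_ring S"
    using h.R.ring_axioms h.S.ring_axioms by (simp_all add: matrix_ring_def)
  note cl = matrix_ring.entry_closed[OF R] matrix_ring.dim_M[OF R]
  show ?thesis
  proof (rule ring_hom_ringI[OF matrix_ring.ring_M[OF R] matrix_ring.ring_M[OF S]])
    fix A assume A: "A \<in> carrier (mat_ring n R)"
    then show "map_mat h A \<in> carrier (mat_ring n S)"
      by (simp add: matrix_ring.carrier_M_iff[OF S] cl)
    fix B assume B: "B \<in> carrier (mat_ring n R)"
    show "map_mat h (A \<oplus>\<^bsub>mat_ring n R\<^esub> B) = map_mat h A \<oplus>\<^bsub>mat_ring n S\<^esub> map_mat h B"
      using A B by (intro eq_matI) (auto simp: matrix_ring.M_ops[OF R] matrix_ring.M_ops[OF S] cl)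
    show "map_mat h (A \<otimes>\<^bsub>mat_ring n R\<^esub> B) = map_mat h A \<otimes>\<^bsub>mat_ring n S\<^esub> map_mat h B"
    proof (rule eq_matI)
      fix i j
      assume "i < dim_row (map_mat h A \<otimes>\<^bsub>mat_ring n S\<^esub> map_mat h B)"
        and "j < dim_col (map_mat h A \<otimes>\<^bsub>mat_ring n S\<^esub> map_mat h B)"
      then have ij: "i < n" "j < n" by (simp_all add: matrix_ring.M_ops[OF S])
      have "map_mat h (A \<otimes>\<^bsub>mat_ring n R\<^esub> B) $$ (i, j) =
          (\<Oplus>\<^bsub>S\<^esub>k\<in>{..<n}. h (A $$ (i, k) \<otimes>\<^bsub>R\<^esub> B $$ (k, j)))"
        using A B ij
        by (simp add: matrix_ring.M_ops[OF R]) (subst h.hom_finsum_ring; simp add: cl)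
      also have "\<dots> = (\<Oplus>\<^bsub>S\<^esub>k\<in>{..<n}. map_mat h A $$ (i, k) \<otimes>\<^bsub>S\<^esub> map_mat h B $$ (k, j))"
        using A B ij by (intro h.S.finsum_cong') (auto simp: cl)
      finally show "map_mat h (A \<otimes>\<^bsub>mat_ring n R\<^esub> B) $$ (i, j) =
          (map_mat h A \<otimes>\<^bsub>mat_ring n S\<^esub> map_mat h B) $$ (i, j)"
        using ij by (simp add: matrix_ring.M_ops[OF S])
    qed (use A B in \<open>simp_all add: matrix_ring.M_ops[OF R] matrix_ring.M_ops[OF S] cl\<close>)
  next
    show "map_mat h \<one>\<^bsub>mat_ring n R\<^esub> = \<one>\<^bsub>mat_ring n S\<^esub>"
      by (intro eq_matI) (auto simp: matrix_ring.M_ops[OF R] matrix_ring.M_ops[OF S])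
  qed
qed

context matrix_ring
begin

abbreviation red :: "'a set \<Rightarrow> 'a mat \<Rightarrow> 'a set mat" where
  "red I \<equiv> map_mat (\<lambda>x. I +> x)"

lemma red_hom: "ideal I R \<Longrightarrow> ring_hom_ring M (mat_ring n (R Quot I)) (red I)"
  by (intro map_mat_ring_hom ideal.rcos_ring_hom_ring)

lemma red_eq_zero_iff:
  assumes "ideal I R" "A \<in> carrier M"
  shows "red I A = \<zero>\<^bsub>mat_ring n (R Quot I)\<^esub> \<longleftrightarrow> A \<in> mats I"
proof -
  interpret I: ideal I R by fact
  have "I +> x = I \<longleftrightarrow> x \<in> I" if "x \<in> carrier R" for x
    using that I.rcos_const_imp_mem I.a_rcos_const by blast
  moreover have "\<zero>\<^bsub>mat_ring n (R Quot I)\<^esub> = mat n n (\<lambda>(i, j). I)"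
    by (simp add: mat_ring_def FactRing_def)
  ultimately show ?thesis
    using assms(2) by (auto simp: mats_def mat_eq_iff)
qed

lemma red_eq_iff:
  assumes "ideal I R" "A \<in> carrier M" "B \<in> carrier M"
  shows "red I A = red I B \<longleftrightarrow> A \<^bold>- B \<in> mats I"
proof -
  interpret F: ring_hom_ring M "mat_ring n (R Quot I)" "red I" using assms(1) by (rule red_hom)
  have "red I (A \<^bold>- B) = red I A \<ominus>\<^bsub>mat_ring n (R Quot I)\<^esub> red I B"
    using assms by (simp add: M.minus_eq F.S.minus_eq)
  then show ?thesis
    using assms red_eq_zero_iff[OF assms(1), of "A \<^bold>- B"] by (simp add: F.S.minus_eq_zero_iff)
qed

lemma red_U_eq:
  assumes "ideal I R" "x \<in> carrier R" "y \<in> carrier R" "x \<ominus> y \<in> I"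
  shows "red I (U i j x) = red I (U i j y)"
proof -
  have "U i j x \<^bold>- U i j y = U i j (x \<ominus> y)"
    using assms by (simp add: minus_eq M.minus_eq U_add U_uminus)
  then show ?thesis
    using assms U_in_mats[of I "x \<ominus> y" i j] by (simp add: red_eq_iff)
qed

lemma minv_mult:
  assumes "g \<in> Units M" "h \<in> Units M"
  shows "minv (g \<cdot> h) = minv h \<cdot> minv g"
  using assms by (intro M.inv_char) (simp_all add: mat_simps)

end

section \<open>The commutator formula\<close>

context splitting_matrix_ring
begin

lemma elementary_ideal_conj:
  assumes I: "ideal I R" and "g \<in> Units M" "x \<in> EI I"
  shows "g \<cdot> x \<cdot> minv g \<in> EI I"
proof -
  \<comment> \<open>The elements all of whose GL(n,R)-conjugates lie in E(n,I). They form a subgroup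
    normalized by \<open>E\<close> and include the transvections over \<open>I\<close>, so
    minimality applies.\<close>
  define H where "H = {x \<in> Units M. \<forall>g\<in>Units M. g \<cdot> x \<cdot> minv g \<in> EI I}"
  note EIc = elementary_ideal_closed[OF I]
  have IR: "I \<subseteq> carrier R" using ideal.Icarr[OF I] by blast
  have "EI I \<subseteq> H"
  proof (rule elementary_ideal_minimal[OF IR])
    show "subgroup H (GL n R)"
    proof (rule GL_subgroupI)
      show "\<^bold>1 \<in> H" using EIc(1) by (auto simp: H_def M.Units_closed)
    next
      fix x y assume xy: "x \<in> H" "y \<in> H"
      have "g \<cdot> (x \<cdot> y) \<cdot> minv g = (g \<cdot> x \<cdot> minv g) \<cdot> (g \<cdot> y \<cdot> minv g)" if "g \<in> Units M" for g
        using that xy by (simp add: H_def mat_simps)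
      with xy show "x \<cdot> y \<in> H" using EIc(2) by (simp add: H_def)
    next
      fix x assume x: "x \<in> H"
      have "g \<cdot> minv x \<cdot> minv g = minv (g \<cdot> x \<cdot> minv g)" if "g \<in> Units M" for g
        using that x by (simp add: H_def minv_mult mat_simps)
      with x show "minv x \<in> H" using EIc(3) by (simp add: H_def)
    qed (auto simp: H_def)
  next
    fix i j x assume "i < n" "j < n" "i \<noteq> j" "x \<in> I"
    then show "\<^bold>1 \<^bold>+ U i j x \<in> H"
      using conj_transvection_in_elementary_ideal[OF I] IR transvection_unit
      by (auto simp: H_def)
  next
    fix h x assume hx: "h \<in> E" "x \<in> H"
    then have h: "h \<in> Units M" by (intro E_closed(4))
    have "g \<cdot> (h \<cdot> x \<cdot> minv h) \<cdot> minv g = (g \<cdot> h) \<cdot> x \<cdot> minv (g \<cdot> h)" if "g \<in> Units M" for g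
      using that h hx by (simp add: H_def minv_mult mat_simps)
    with hx h show "h \<cdot> x \<cdot> minv h \<in> H" by (simp add: H_def)
  qed
  with assms show ?thesis by (auto simp: H_def)
qed

lemma elementary_ideal_normal:
  assumes I: "ideal I R"
  shows "EI I \<lhd> GL n R"
proof -
  have "I \<subseteq> carrier R" using ideal.Icarr[OF I] by blast
  then show ?thesis
    unfolding group.normal_inv_iff[OF GL_group]
    using elementary_ideal(1) elementary_ideal_conj[OF I] by (auto simp: GL_simps GL_inv)
qed

text \<open>Commuting modulo \<open>I\<close> makes a = W_ii g_ii congruent to 1 and so puts d2 into
  \<open>I\<close>. The d2 part of the conjugate of T = t_ij(r) by \<open>g\<close> then lies in
  E(n,I); the d1 part is, after conjugation by some h \<in> E(n,I), equal to T times an element of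
  E(n,I).\<close>

lemma commutator_in_elementary_ideal:
  assumes I: "ideal I R" and g: "g \<in> Units M" and ij: "i < n" "j < n" "i \<noteq> j" and r: "r \<in> carrier R"
    and comm: "\<And>i j s. i < n \<Longrightarrow> j < n \<Longrightarrow> i \<noteq> j \<Longrightarrow> s \<in> carrier R \<Longrightarrow>
      red I (g \<cdot> U i j s) = red I (U i j s \<cdot> g)"
  shows "g \<cdot> (\<^bold>1 \<^bold>+ U i j r) \<cdot> minv g \<cdot> minv (\<^bold>1 \<^bold>+ U i j r) \<in> EI I"
proof -
  interpret I: ideal I R by fact
  interpret F: ring_hom_ring M "mat_ring n (R Quot I)" "red I" using I by (rule red_hom)
  note EIc = elementary_ideal_closed[OF I]
  have IR: "I \<subseteq> carrier R" using I.a_Hcarr by blast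
  define W where "W = minv g"
  have W: "W \<in> Units M" "g \<cdot> W = \<^bold>1" "W \<cdot> g = \<^bold>1" using g by (simp_all add: W_def)
  have cl: "g \<in> carrier M" "W \<in> carrier M" using g W by auto
  \<comment> \<open>The hypothesis covers off-diagonal units; a diagonal one is a product of two of
    them.\<close>
  have comm1: "red I (g \<cdot> U k i s) = red I (U k i s \<cdot> g)" if "k < n" "s \<in> carrier R" for k s
  proof (cases "k = i")
    case True
    have "red I (g \<cdot> U i i s) = red I (g \<cdot> U i j s \<cdot> U j i \<one>)"
      using that cl ij by (simp add: M.m_assoc U_mult_U del: F.hom_mult)
    also have "\<dots> = red I (U i j s \<cdot> (g \<cdot> U j i \<one>))"
      using that cl ij comm[of i j s] by (simp add: F.S.m_assoc)
    also have "\<dots> = red I (U i j s \<cdot> (U j i \<one> \<cdot> g))"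
      using that cl ij comm[of j i \<one>] by simp
    also have "\<dots> = red I (U i i s \<cdot> g)"
      using that cl ij by (simp add: U_mult_U_left del: F.hom_mult)
    finally show ?thesis using True by simp
  qed (use comm that ij in auto)
  have commW: "red I (W \<cdot> U k l s) = red I (U k l s \<cdot> W)"
    if "red I (g \<cdot> U k l s) = red I (U k l s \<cdot> g)" "s \<in> carrier R" for k l s
  proof -
    have "red I (W \<cdot> U k l s) = red I (W \<cdot> (U k l s \<cdot> g) \<cdot> W)"
      using that cl W by (simp add: M.m_assoc del: F.hom_mult)
    also have "\<dots> = red I (W \<cdot> (g \<cdot> U k l s) \<cdot> W)"
      using that cl by simp
    also have "\<dots> = red I (U k l s \<cdot> W)"
      using that cl g by (simp add: W_def minv_cancel M.m_assoc[symmetric] del: F.hom_mult)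
    finally show ?thesis .
  qed
  define a where "a = W $$ (i, i) \<otimes> g $$ (i, i)"
  have a: "a \<in> carrier R" using cl ij by (simp add: a_def)
  obtain d1 d2 m1 m2 where d: "d1 \<in> carrier R" "d2 \<in> carrier R" "m1 \<in> carrier R" "m2 \<in> carrier R"
    "d1 \<oplus> d2 = \<one>" "m1 \<otimes> a \<otimes> d1 = d1" "m2 \<otimes> (\<one> \<ominus> a) \<otimes> d2 = d2"
    using splitting[OF a] by blast
  have gc: "g $$ (i, i) \<in> carrier R" "W $$ (i, i) \<in> carrier R" using cl ij by auto
  \<comment> \<open>Modulo \<open>I\<close> the idempotent e_ii moves past \<open>g\<close>, so that
    \<open>W\<close> and \<open>g\<close> meet and cancel.\<close>
  have "red I (U i i a) = red I (e i \<cdot> (W \<cdot> (e i \<cdot> (g \<cdot> e i))))"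
    using cl ij gc by (simp add: U_sandwich' a_def del: F.hom_mult)
  also have "\<dots> = red I (e i \<cdot> (W \<cdot> (e i \<cdot> g \<cdot> e i)))"
    using cl by (simp add: M.m_assoc del: F.hom_mult)
  also have "\<dots> = red I (e i \<cdot> (W \<cdot> (g \<cdot> e i \<cdot> e i)))"
    using cl comm1[OF ij(1) one_closed] by simp
  also have "\<dots> = red I (e i)"
    using g ij by (simp add: W_def mat_simps del: F.hom_mult)
  finally have "U i i a \<^bold>- e i \<in> mats I"
    using a by (simp add: red_eq_iff[OF I])
  from mats_entry[OF this ij(1) ij(1)] have "a \<ominus> \<one> \<in> I" using a ij by simp
  then have "\<ominus> (a \<ominus> \<one>) \<in> I" by simp
  moreover have "\<ominus> (a \<ominus> \<one>) = \<one> \<ominus> a" using a by algebra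
  ultimately have "\<one> \<ominus> a \<in> I" by simp
  then have "m2 \<otimes> (\<one> \<ominus> a) \<otimes> d2 \<in> I"
    using d by (intro I.I_r_closed I.I_l_closed)
  then have d2I: "d2 \<in> I" using d(7) by simp
  define m where "m = m1 \<otimes> W $$ (i, i)"
  have m: "m \<in> carrier R" using d gc by (simp add: m_def)
  have mgd: "m \<otimes> g $$ (i, i) \<otimes> d1 = d1"
    using d gc by (simp add: m_def a_def m_assoc)
  \<comment> \<open>Its entries -g_ki m, k \<noteq> i, are chosen so that 1 + \<open>Z0\<close>
    clears every coordinate of the column g e_i d1 except the one at \<open>i\<close>. They lie in
    \<open>I\<close> because \<open>g\<close> commutes with m e_ii modulo \<open>I\<close>.\<close>
  define Z0 where "Z0 = \<ominus>\<^bsub>M\<^esub> ((\<^bold>1 \<^bold>- e i) \<cdot> (g \<cdot> U i i m))"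
  define h where "h = \<^bold>1 \<^bold>+ Z0"
  have Z0: "Z0 \<in> carrier M" using cl m by (simp add: Z0_def)
  have "red I ((\<^bold>1 \<^bold>- e i) \<cdot> (g \<cdot> U i i m)) = red I ((\<^bold>1 \<^bold>- e i) \<cdot> (U i i m \<cdot> g))"
    using cl m comm1[OF ij(1) m] by simp
  also have "(\<^bold>1 \<^bold>- e i) \<cdot> (U i i m \<cdot> g) = \<^bold>0"
    using cl m ij by (simp add: M.minus_eq M.l_distr M.l_minus U_mult_U_left M.r_neg)
  finally have "(\<^bold>1 \<^bold>- e i) \<cdot> (g \<cdot> U i i m) \<in> mats I"
    using cl m I by (simp add: red_eq_zero_iff[symmetric] del: F.hom_mult)
  then have Z0I: "Z0 \<in> mats I" unfolding Z0_def by (auto simp: mats_def)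
  have hE: "h \<in> EI I"
    unfolding h_def
  proof (intro EIc(5) col_unipotent[OF IR ij(1) Z0I])
    show "Z0 \<cdot> e i = Z0"
      using cl m ij by (simp add: Z0_def M.l_minus mat_simps)
    show "e i \<cdot> Z0 = \<^bold>0"
      using cl m ij by (simp add: Z0_def M.minus_eq M.l_distr M.r_distr M.r_minus M.l_minus U_mult_U_left M.r_neg)
  qed
  then have hU: "h \<in> Units M" by (rule EIc(4))
  note hc = M.Units_closed[OF hU] M.Units_inv_closed[OF hU]
  have "h \<^bold>- \<^bold>1 = Z0"
    using Z0 unfolding h_def by algebra
  then have redh: "red I h = red I \<^bold>1"
    using hc Z0I by (simp add: red_eq_iff[OF I] del: F.hom_one)
  have "red I (minv h) = red I (minv h \<cdot> h)" using hc redh by simp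
  then have redh': "red I (minv h) = red I \<^bold>1" using hU by (simp del: F.hom_mult)
  have hgd: "h \<cdot> (g \<cdot> U i i d1) = U i i (g $$ (i, i) \<otimes> d1)"
  proof -
    have "h \<cdot> (g \<cdot> U i i d1) = g \<cdot> U i i d1 \<^bold>- (\<^bold>1 \<^bold>- e i) \<cdot> (g \<cdot> (U i i m \<cdot> (g \<cdot> U i i d1)))"
      using cl m d by (simp add: h_def Z0_def M.l_distr M.l_minus M.minus_eq M.m_assoc)
    also have "U i i m \<cdot> (g \<cdot> U i i d1) = U i i d1"
      using cl m d ij by (simp add: U_sandwich' mgd)
    also have "g \<cdot> U i i d1 \<^bold>- (\<^bold>1 \<^bold>- e i) \<cdot> (g \<cdot> U i i d1) = e i \<cdot> (g \<cdot> U i i d1)"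
      using cl d by (simp add: M.l_distr M.minus_eq M.l_minus M.minus_add M.r_neg1 M.r_neg2)
    finally show ?thesis using cl d gc ij by (simp add: U_sandwich')
  qed
  \<comment> \<open>After conjugation by \<open>h\<close> the d1 part is supported in row
    \<open>i\<close>: it is 1 + y e_ii Q, where row \<open>i\<close> of \<open>Q\<close> is row
    \<open>j\<close> of the inverse of h g.\<close>
  define y where "y = g $$ (i, i) \<otimes> d1 \<otimes> r"
  define Q where "Q = U i j \<one> \<cdot> (W \<cdot> minv h)"
  have yc: "y \<in> carrier R" and Qc: "Q \<in> carrier M"
    using gc d r hc cl by (simp_all add: y_def Q_def)
  have conj: "h \<cdot> (\<^bold>1 \<^bold>+ g \<cdot> U i j (d1 \<otimes> r) \<cdot> W) \<cdot> minv h = \<^bold>1 \<^bold>+ U i i y \<cdot> Q"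
  proof -
    have "h \<cdot> (g \<cdot> U i j (d1 \<otimes> r) \<cdot> W) \<cdot> minv h = h \<cdot> (g \<cdot> U i i d1) \<cdot> (U i j r \<cdot> (W \<cdot> minv h))"
      using cl hc d r ij by (simp add: M.m_assoc U_mult_U_left)
    also have "\<dots> = U i i y \<cdot> Q"
      unfolding hgd using cl hc gc d r ij by (simp add: U_mult_U_left y_def Q_def m_assoc)
    finally show ?thesis
      using cl hc d r hU by (simp add: M.conj_one_plus)
  qed
  define q where "q = Q $$ (i, i)"
  have qc: "q \<in> carrier R" using Qc ij by (simp add: q_def)
  \<comment> \<open>Row \<open>j\<close> of the inverse of h g annihilates column \<open>i\<close>
    of h g. That column times \<open>d1\<close> is supported at \<open>i\<close>, so only q g_ii d1
    is left.\<close>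
  have "Q \<cdot> (h \<cdot> (g \<cdot> U i i d1)) = \<^bold>0"
    using g hU hc d ij by (simp add: Q_def W_def mat_simps)
  then have "(Q \<cdot> U i i (g $$ (i, i) \<otimes> d1)) $$ (i, i) = \<zero>"
    unfolding hgd using ij by simp
  then have "q \<otimes> (g $$ (i, i) \<otimes> d1) = \<zero>"
    using Qc gc d ij by (simp add: q_def)
  then have "q \<otimes> (g $$ (i, i) \<otimes> d1) \<otimes> r = \<zero> \<otimes> r" by simp
  then have qy: "q \<otimes> y = \<zero>"
    using qc gc d r by (simp add: y_def m_assoc)
  have redQ: "red I Q = red I (U i j \<one> \<cdot> W)"
    using cl hc by (simp add: Q_def redh' F.S.m_assoc[symmetric])
  have "red I (Q \<cdot> e i) = red I (U i j \<one> \<cdot> (e i \<cdot> W))"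
    using cl Qc commW[OF comm1[OF ij(1) one_closed] one_closed] by (simp add: redQ F.S.m_assoc)
  also have "U i j \<one> \<cdot> (e i \<cdot> W) = \<^bold>0"
    using cl ij by (simp add: U_mult_U_left)
  finally have "Q \<cdot> e i \<in> mats I"
    using Qc I by (simp add: red_eq_zero_iff[symmetric] del: F.hom_mult)
  from mats_entry[OF this ij(1) ij(1)] have qI: "q \<in> I"
    using Qc ij by (simp add: q_def)
  \<comment> \<open>Because q y = 0, the diagonal part 1 + y q e_ii is the commutator of t_ij(y) and
    t_ji(q), and \<open>q \<in> I\<close> puts it into E(n,I).\<close>
  have diag: "\<^bold>1 \<^bold>+ U i i (y \<otimes> q) \<in> EI I"
  proof -
    have P: "\<^bold>1 \<^bold>+ U i j y \<in> E" using ij yc by (intro transvection_in_E)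
    have Y: "\<^bold>1 \<^bold>+ U j i q \<in> EI I"
      using ij qI by (intro EIc(5) transvection_in_elementary_gen) auto
    have "(\<^bold>1 \<^bold>+ U i j y) \<cdot> (\<^bold>1 \<^bold>+ U j i q) \<cdot> (\<^bold>1 \<^bold>- U i j y) \<cdot> (\<^bold>1 \<^bold>- U j i q) \<in> EI I"
      using EIc(2)[OF EIc(6)[OF P Y] EIc(3)[OF Y]] ij yc qc
      by (simp add: transvection_unit)
    also have "(\<^bold>1 \<^bold>+ U i j y) \<cdot> (\<^bold>1 \<^bold>+ U j i q) \<cdot> (\<^bold>1 \<^bold>- U i j y) \<cdot> (\<^bold>1 \<^bold>- U j i q) =
        \<^bold>1 \<^bold>+ U i j y \<cdot> U j i q"
      using ij yc qc qy by (intro M.unipotent_commutator) (simp_all add: U_mult_U)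
    finally show ?thesis using ij yc qc by (simp add: U_mult_U)
  qed
  define Z where "Z = U i i y \<cdot> (Q \<cdot> (\<^bold>1 \<^bold>- e i))"
  have Zc: "Z \<in> carrier M" using yc Qc by (simp add: Z_def)
  \<comment> \<open>Modulo \<open>I\<close>, both \<open>h\<close> and \<open>d1\<close> become 1
    and \<open>g\<close> commutes with r e_ij. Hence the off-diagonal part of the row differs from r
    e_ij by a matrix over \<open>I\<close>.\<close>
  have redZ: "red I Z = red I (U i j r)"
  proof -
    have "red I (W \<cdot> (\<^bold>1 \<^bold>- e i)) = red I ((\<^bold>1 \<^bold>- e i) \<cdot> W)"
    proof -
      have "W \<cdot> (\<^bold>1 \<^bold>- e i) = W \<^bold>+ \<ominus>\<^bsub>M\<^esub> (W \<cdot> e i)" "(\<^bold>1 \<^bold>- e i) \<cdot> W = W \<^bold>+ \<ominus>\<^bsub>M\<^esub> (e i \<cdot> W)"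
        using cl by (simp_all add: M.minus_eq M.l_distr M.r_distr M.l_minus M.r_minus)
      then show ?thesis
        using cl commW[OF comm1[OF ij(1) one_closed] one_closed] by (simp del: F.hom_mult)
    qed
    then have "red I Z = red I (U i i y \<cdot> (U i j \<one> \<cdot> ((\<^bold>1 \<^bold>- e i) \<cdot> W)))"
      using yc cl Qc redQ by (simp add: Z_def F.S.m_assoc)
    also have "U i i y \<cdot> (U i j \<one> \<cdot> ((\<^bold>1 \<^bold>- e i) \<cdot> W)) = U i j y \<cdot> W"
      using yc cl ij by (simp add: M.minus_eq M.l_distr M.r_distr M.l_minus M.r_minus U_mult_U_left)
    also have "U i j y = h \<cdot> (g \<cdot> U i i d1) \<cdot> U i j r"
      unfolding hgd using gc d r ij by (simp add: U_mult_U y_def)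
    also have "h \<cdot> (g \<cdot> U i i d1) \<cdot> U i j r = h \<cdot> (g \<cdot> U i j (d1 \<otimes> r))"
      using hc cl d r ij by (simp add: M.m_assoc U_mult_U)
    also have "red I (h \<cdot> (g \<cdot> U i j (d1 \<otimes> r)) \<cdot> W) = red I (g \<cdot> U i j (d1 \<otimes> r) \<cdot> W)"
      using hc cl d r by (simp add: redh)
    also have "\<dots> = red I (g \<cdot> U i j r \<cdot> W)"
    proof -
      have "d1 \<otimes> r \<ominus> r = \<ominus> (d2 \<otimes> r)"
      proof -
        have "r = (d1 \<oplus> d2) \<otimes> r" using d(5) r by simp
        then have "d1 \<otimes> r \<ominus> r = d1 \<otimes> r \<ominus> (d1 \<oplus> d2) \<otimes> r" by simp
        also have "\<dots> = \<ominus> (d2 \<otimes> r)" using d(1,2) r by algebra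
        finally show ?thesis .
      qed
      then have "d1 \<otimes> r \<ominus> r \<in> I" using d2I r by (simp add: I.I_r_closed)
      then show ?thesis
        using cl d r red_U_eq[OF I, of "d1 \<otimes> r" r i j] by simp
    qed
    also have "\<dots> = red I (U i j r \<cdot> (g \<cdot> W))"
      using cl r comm[OF ij r] by (simp add: F.S.m_assoc)
    finally show ?thesis using W r by (simp del: F.hom_mult)
  qed
  define Z' where "Z' = Z \<^bold>- U i j r"
  have Z': "Z' \<in> mats I" "Z' \<in> carrier M"
    using redZ Zc r by (simp_all add: Z'_def red_eq_iff[OF I])
  have Ze: "Z \<cdot> e i = \<^bold>0" "e i \<cdot> Z = Z"
    using yc Qc ij
    by (simp_all add: Z_def M.m_assoc M.minus_eq M.l_distr M.r_distr M.l_minus M.r_minus U_mult_U U_mult_U_left M.r_neg)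
  have Z'E: "\<^bold>1 \<^bold>+ Z' \<in> EI I"
  proof (intro EIc(5) row_unipotent[OF IR ij(1) Z'(1)])
    show "e i \<cdot> Z' = Z'" "Z' \<cdot> e i = \<^bold>0"
      using Zc r ij Ze
      by (simp_all add: Z'_def M.minus_eq M.l_distr M.r_distr M.l_minus M.r_minus U_mult_U)
  qed
  define T where "T = \<^bold>1 \<^bold>+ U i j r"
  have TE: "T \<in> E" and TU: "T \<in> Units M" "T \<in> carrier M"
    using ij r transvection_unit by (auto simp: T_def intro: transvection_in_E)
  have UZ: "U i j r \<cdot> Z' = \<^bold>0"
  proof -
    have "U i j r \<cdot> Z = U i j r \<cdot> (e i \<cdot> Z)" using Ze by simp
    also have "\<dots> = \<^bold>0" using Zc r ij by (simp add: U_mult_U_left)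
    finally show ?thesis
      using Zc r ij by (simp add: Z'_def M.minus_eq M.r_distr M.r_minus U_mult_U)
  qed
  have TZ: "T \<cdot> (\<^bold>1 \<^bold>+ Z') = \<^bold>1 \<^bold>+ Z"
  proof -
    have "T \<cdot> (\<^bold>1 \<^bold>+ Z') = \<^bold>1 \<^bold>+ (U i j r \<^bold>+ Z') \<^bold>+ U i j r \<cdot> Z'"
      using Z'(2) r by (simp add: T_def M.l_distr M.r_distr M.a_ac)
    also have "U i j r \<^bold>+ Z' = Z"
      using Zc r by (simp add: Z'_def M.minus_eq M.a_ac M.r_neg1 M.r_neg2 M.r_neg)
    finally show ?thesis using Zc by (simp add: UZ)
  qed
  have ZU: "(\<^bold>1 \<^bold>+ Z) \<cdot> (\<^bold>1 \<^bold>+ U i i (y \<otimes> q)) = \<^bold>1 \<^bold>+ U i i y \<cdot> Q"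
  proof -
    have "Z \<cdot> U i i (y \<otimes> q) = Z \<cdot> e i \<cdot> U i i (y \<otimes> q)"
      using Zc yc qc ij by (simp add: M.m_assoc U_mult_U)
    then have "Z \<cdot> U i i (y \<otimes> q) = \<^bold>0" using yc qc by (simp add: Ze)
    then have "(\<^bold>1 \<^bold>+ Z) \<cdot> (\<^bold>1 \<^bold>+ U i i (y \<otimes> q)) = \<^bold>1 \<^bold>+ (Z \<^bold>+ U i i (y \<otimes> q))"
      using Zc yc qc by (simp add: M.l_distr M.r_distr M.a_ac)
    moreover have "U i i (y \<otimes> q) = U i i y \<cdot> (Q \<cdot> e i)"
      using yc Qc ij by (simp add: U_sandwich' q_def)
    moreover have "Z \<^bold>+ U i i y \<cdot> (Q \<cdot> e i) = U i i y \<cdot> Q"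
      using yc Qc by (simp add: Z_def M.minus_eq M.r_distr M.r_minus M.a_assoc M.l_neg)
    ultimately show ?thesis by simp
  qed
  \<comment> \<open>The error term: 1 + y e_ii Q is \<open>T\<close> times this element of
    E(n,I).\<close>
  define \<epsilon> where "\<epsilon> = (\<^bold>1 \<^bold>+ Z') \<cdot> (\<^bold>1 \<^bold>+ U i i (y \<otimes> q))"
  have \<epsilon>: "\<epsilon> \<in> EI I" using EIc(2)[OF Z'E diag] by (simp add: \<epsilon>_def)
  then have \<epsilon>c: "\<epsilon> \<in> carrier M" using EIc(4) by blast
  have conj': "h \<cdot> (\<^bold>1 \<^bold>+ g \<cdot> U i j (d1 \<otimes> r) \<cdot> W) \<cdot> minv h = T \<cdot> \<epsilon>"
    unfolding conj \<epsilon>_def using TU Z'(2) yc qc TZ ZU by (simp add: M.m_assoc[symmetric])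
  define A1 A2 where "A1 = \<^bold>1 \<^bold>+ g \<cdot> U i j (d1 \<otimes> r) \<cdot> W"
    and "A2 = g \<cdot> (\<^bold>1 \<^bold>+ U i j (d2 \<otimes> r)) \<cdot> W"
  have A1c: "A1 \<in> carrier M" using cl d r by (simp add: A1_def)
  have A2: "A2 \<in> EI I"
    unfolding A2_def W_def using d2I r
    by (intro conj_transvection_in_elementary_ideal[OF I g ij]) (simp add: I.I_r_closed)
  have "A1 = minv h \<cdot> (h \<cdot> A1 \<cdot> minv h) \<cdot> h"
    using hU A1c by (simp add: mat_simps)
  then have A1: "A1 = minv h \<cdot> (T \<cdot> \<epsilon>) \<cdot> h"
    using conj' by (simp add: A1_def)
  have "g \<cdot> T \<cdot> W = A2 \<cdot> A1"
  proof -
    have "A1 = g \<cdot> (\<^bold>1 \<^bold>+ U i j (d1 \<otimes> r)) \<cdot> W"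
      using g d r unfolding A1_def W_def by (simp add: M.conj_one_plus)
    then have "A2 \<cdot> A1 = g \<cdot> ((\<^bold>1 \<^bold>+ U i j (d2 \<otimes> r)) \<cdot> (\<^bold>1 \<^bold>+ U i j (d1 \<otimes> r))) \<cdot> W"
      using g d r unfolding A2_def W_def by (simp add: mat_simps)
    also have "(\<^bold>1 \<^bold>+ U i j (d2 \<otimes> r)) \<cdot> (\<^bold>1 \<^bold>+ U i j (d1 \<otimes> r)) =
        \<^bold>1 \<^bold>+ U i j ((d1 \<oplus> d2) \<otimes> r) \<^bold>+ U i j (d2 \<otimes> r) \<cdot> U i j (d1 \<otimes> r)"
      using d(1,2) r by (simp add: M.l_distr M.r_distr l_distr U_add M.a_ac)
    also have "\<dots> = T" using d r ij by (simp add: U_mult_U T_def)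
    finally show ?thesis by simp
  qed
  \<comment> \<open>Regrouped so that \<open>T\<close> acts by conjugation on \<epsilon> h; then
    every factor lies in E(n,I).\<close>
  also have "A2 \<cdot> A1 \<cdot> minv T = A2 \<cdot> (minv h \<cdot> (T \<cdot> (\<epsilon> \<cdot> h) \<cdot> minv T))"
    unfolding A1 using A2[THEN EIc(4)] hU TU \<epsilon>c hc by (simp add: M.m_assoc M.Units_closed)
  finally have "g \<cdot> T \<cdot> W \<cdot> minv T = A2 \<cdot> (minv h \<cdot> (T \<cdot> (\<epsilon> \<cdot> h) \<cdot> minv T))" .
  also have "\<dots> \<in> EI I"
    by (rule EIc(2)[OF A2 EIc(2)[OF EIc(3)[OF hE] EIc(6)[OF TE EIc(2)[OF \<epsilon> hE]]]])
  finally show ?thesis by (simp add: T_def W_def)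
qed

end

section \<open>Full congruence subgroups and the Steinberg relation\<close>

lemma (in ring) a_left_cancel:
  assumes "x \<in> carrier R" "y \<in> carrier R" "z \<in> carrier R"
  shows "x \<oplus> y = x \<oplus> z \<longleftrightarrow> y = z"
  using assms by (metis a_assoc l_neg l_zero a_inv_closed)

lemma third_index: "n \<ge> 3 \<Longrightarrow> \<exists>k<n. k \<noteq> i \<and> k \<noteq> (j::nat)"
  by presburger

context matrix_ring
begin

lemma red_unit:
  assumes "ideal I R" "A \<in> Units M"
  shows "red I A \<in> Units (mat_ring n (R Quot I))"
    and "inv\<^bsub>mat_ring n (R Quot I)\<^esub> (red I A) = red I (minv A)"
proof -
  interpret F: ring_hom_ring M "mat_ring n (R Quot I)" "red I" using assms(1) by (rule red_hom)
  have A: "A \<in> carrier M" "minv A \<in> carrier M" using assms(2) by auto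
  have "red I (A \<cdot> minv A) = red I \<^bold>1" "red I (minv A \<cdot> A) = red I \<^bold>1"
    using assms(2) by (simp_all del: F.hom_mult F.hom_one)
  then have *: "red I A \<otimes>\<^bsub>mat_ring n (R Quot I)\<^esub> red I (minv A) = \<one>\<^bsub>mat_ring n (R Quot I)\<^esub>"
    "red I (minv A) \<otimes>\<^bsub>mat_ring n (R Quot I)\<^esub> red I A = \<one>\<^bsub>mat_ring n (R Quot I)\<^esub>"
    using A by simp_all
  then show "red I A \<in> Units (mat_ring n (R Quot I))"
    unfolding Units_def using F.hom_closed[OF A(1)] F.hom_closed[OF A(2)] by blast
  show "inv\<^bsub>mat_ring n (R Quot I)\<^esub> (red I A) = red I (minv A)"
    using * A by (intro F.S.inv_char) simp_all
qed

text \<open>Transvections over R are among the matrices whose reductions commute with that of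
  \<open>g\<close>; cancelling the summand 1 leaves multiples of matrix units.\<close>

lemma congruence_fullD:
  assumes I: "ideal I R" and g: "g \<in> congruence_full n R I"
  shows "g \<in> Units M"
    and "h \<in> Units M \<Longrightarrow> red I (g \<cdot> h) = red I (h \<cdot> g)"
    and "s \<in> carrier R \<Longrightarrow> i < n \<Longrightarrow> j < n \<Longrightarrow> i \<noteq> j \<Longrightarrow> red I (g \<cdot> U i j s) = red I (U i j s \<cdot> g)"
proof -
  interpret F: ring_hom_ring M "mat_ring n (R Quot I)" "red I" using I by (rule red_hom)
  show gU: "g \<in> Units M" using g by (simp add: congruence_full_def GL_simps)
  have *: "red I (g \<cdot> h) = red I (h \<cdot> g)" if "h \<in> Units M" for h
    using g that gU red_unit(1)[OF I that]
    by (simp add: congruence_full_def center_def GL_simps M.Units_closed)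
  then show "h \<in> Units M \<Longrightarrow> red I (g \<cdot> h) = red I (h \<cdot> g)" .
  show "red I (g \<cdot> U i j s) = red I (U i j s \<cdot> g)"
    if "s \<in> carrier R" "i < n" "j < n" "i \<noteq> j" for i j s
  proof -
    have "red I (g \<cdot> (\<^bold>1 \<^bold>+ U i j s)) = red I ((\<^bold>1 \<^bold>+ U i j s) \<cdot> g)"
      using that transvection_unit by (intro *) auto
    then show ?thesis
      using gU that by (simp add: M.Units_closed M.r_distr M.l_distr F.S.a_left_cancel)
  qed
qed

text \<open>Conjugation does not change a reduction that is central.\<close>

lemma congruence_full_conj:
  assumes I: "ideal I R" and g: "g \<in> congruence_full n R I" and h: "h \<in> Units M"
  shows "h \<cdot> g \<cdot> minv h \<in> congruence_full n R I"
proof -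
  interpret F: ring_hom_ring M "mat_ring n (R Quot I)" "red I" using I by (rule red_hom)
  note gU = congruence_fullD(1)[OF I g]
  have "red I (h \<cdot> g \<cdot> minv h) = red I (g \<cdot> h) \<otimes>\<^bsub>mat_ring n (R Quot I)\<^esub> red I (minv h)"
    using gU h congruence_fullD(2)[OF I g h] by (simp add: M.Units_closed)
  also have "\<dots> = red I (g \<cdot> h \<cdot> minv h)"
    using gU h by (simp add: M.Units_closed)
  also have "g \<cdot> h \<cdot> minv h = g" using gU h by (simp add: mat_simps)
  finally show ?thesis
    using g gU h by (simp add: congruence_full_def GL_simps del: F.hom_mult)
qed

lemma congruence_fullI:
  assumes I: "ideal I R" and g: "g \<in> Units M" and "red I g = red I \<^bold>1"
  shows "g \<in> congruence_full n R I"
proof -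
  interpret F: ring_hom_ring M "mat_ring n (R Quot I)" "red I" using I by (rule red_hom)
  show ?thesis
    using assms F.S.Units_one_closed
    by (auto simp: congruence_full_def center_def GL_simps F.S.Units_closed)
qed

text \<open>The Steinberg relation, an instance of \<open>unipotent_commutator\<close> because e_jk
  e_ij = 0 for \<open>i \<noteq> k\<close>.\<close>

lemma transvection_commutator:
  assumes "i < n" "j < n" "k < n" "i \<noteq> j" "j \<noteq> k" "i \<noteq> k" "x \<in> carrier R" "y \<in> carrier R"
  shows "(\<^bold>1 \<^bold>+ U i j x) \<cdot> (\<^bold>1 \<^bold>+ U j k y) \<cdot> minv (\<^bold>1 \<^bold>+ U i j x) \<cdot> minv (\<^bold>1 \<^bold>+ U j k y) =
    \<^bold>1 \<^bold>+ U i k (x \<otimes> y)"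
proof -
  have "(\<^bold>1 \<^bold>+ U i j x) \<cdot> (\<^bold>1 \<^bold>+ U j k y) \<cdot> (\<^bold>1 \<^bold>- U i j x) \<cdot> (\<^bold>1 \<^bold>- U j k y) =
      \<^bold>1 \<^bold>+ U i j x \<cdot> U j k y"
    using assms by (intro M.unipotent_commutator) (simp_all add: U_mult_U)
  then show ?thesis using assms by (simp add: transvection_unit U_mult_U)
qed

lemma conj_mult:
  assumes "h \<in> Units M" "x \<in> carrier M" "y \<in> carrier M"
  shows "h \<cdot> (x \<cdot> y) \<cdot> minv h = (h \<cdot> x \<cdot> minv h) \<cdot> (h \<cdot> y \<cdot> minv h)"
  using assms by (simp add: mat_simps)

lemma conj_minv:
  assumes "h \<in> Units M" "x \<in> Units M"
  shows "h \<cdot> minv x \<cdot> minv h = minv (h \<cdot> x \<cdot> minv h)"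
  using assms by (simp add: minv_mult mat_simps)

end

context splitting_matrix_ring
begin

lemma commutator_formula:
  assumes n: "n \<ge> 3" and I: "ideal I R"
  shows "commutator_subgroup (GL n R) (congruence_full n R I) E = EI I"
proof -
  interpret I: ideal I R by fact
  interpret F: ring_hom_ring M "mat_ring n (R Quot I)" "red I" using I by (rule red_hom)
  note EIc = elementary_ideal_closed[OF I]
  have IR: "I \<subseteq> carrier R" using I.a_Hcarr by blast
  let ?C = "congruence_full n R I"
  note CD = congruence_fullD[OF I]
  define S where "S = {a \<cdot> b \<cdot> minv a \<cdot> minv b | a b. a \<in> ?C \<and> b \<in> E}"
  define D where "D = generate (GL n R) S"
  have "commutator_subgroup (GL n R) ?C E = D"
    unfolding commutator_subgroup_def D_def S_def
    using CD(1) E_closed(4) by (intro arg_cong[of _ _ "generate _"]) (auto simp: GL_simps GL_inv, metis GL_inv, metis GL_inv)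
  have SU: "S \<subseteq> Units M" using CD(1) E_closed(4) unfolding S_def by auto
  have D: "subgroup D (GL n R)"
    unfolding D_def using SU by (intro group.generate_is_subgroup[OF GL_group]) (simp add: GL_simps)
  note Dc = GL_subgroupD[OF D]
  have "EI I \<subseteq> D"
  proof (rule elementary_ideal_minimal[OF IR D])
    fix i j x assume ij: "i < n" "j < n" "i \<noteq> j" and x: "x \<in> I"
    \<comment> \<open>A third index exhibits t_ij(x) as the commutator of t_ik(x), which reduces to
      1, and t_kj(1).\<close>
    obtain k where k: "k < n" "k \<noteq> i" "k \<noteq> j"
      using third_index[OF n] by blast
    have "red I (U i k x) = red I (U i k \<zero>)"
      using x I.a_Hcarr by (intro red_U_eq[OF I]) (auto simp: minus_eq)
    then have "red I (\<^bold>1 \<^bold>+ U i k x) = red I \<^bold>1"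
      using x I.a_Hcarr by simp
    then have "\<^bold>1 \<^bold>+ U i k x \<in> ?C"
      using ij k x by (intro congruence_fullI[OF I] transvection_unit) auto
    moreover have "\<^bold>1 \<^bold>+ U k j \<one> \<in> E" using ij k by (intro transvection_in_E) auto
    ultimately have "(\<^bold>1 \<^bold>+ U i k x) \<cdot> (\<^bold>1 \<^bold>+ U k j \<one>) \<cdot> minv (\<^bold>1 \<^bold>+ U i k x) \<cdot> minv (\<^bold>1 \<^bold>+ U k j \<one>) \<in> S"
      unfolding S_def by blast
    then show "\<^bold>1 \<^bold>+ U i j x \<in> D"
      using ij k x transvection_commutator[of i k j x \<one>] unfolding D_def by (auto intro: generate.incl)
  next
    fix h x assume hx: "h \<in> E" "x \<in> D"
    have h: "h \<in> Units M" using hx by (intro E_closed(4))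
    \<comment> \<open>Conjugation by \<open>h\<close> takes generating commutators of
      \<open>D\<close> to such commutators, since C(n,I) and \<open>E\<close> are both stable under
      it.\<close>
    define H where "H = {x \<in> Units M. h \<cdot> x \<cdot> minv h \<in> D}"
    have "subgroup H (GL n R)"
    proof (rule GL_subgroupI)
      show "\<^bold>1 \<in> H" using h Dc(2) by (simp add: H_def M.Units_closed)
      show "x \<cdot> y \<in> H" if "x \<in> H" "y \<in> H" for x y
        using that h Dc(3) by (simp add: H_def conj_mult M.Units_closed)
      show "minv x \<in> H" if "x \<in> H" for x
        using that h Dc(4) by (simp add: H_def conj_minv)
    qed (auto simp: H_def)
    moreover have "S \<subseteq> H"
    proof
      fix s assume "s \<in> S"
      then obtain a b where ab: "a \<in> ?C" "b \<in> E" "s = a \<cdot> b \<cdot> minv a \<cdot> minv b"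
        unfolding S_def by blast
      have U: "a \<in> Units M" "b \<in> Units M" using ab CD(1) E_closed(4) by auto
      have "h \<cdot> s \<cdot> minv h = (h \<cdot> a \<cdot> minv h) \<cdot> (h \<cdot> b \<cdot> minv h) \<cdot> minv (h \<cdot> a \<cdot> minv h) \<cdot> minv (h \<cdot> b \<cdot> minv h)"
        using U h by (simp add: ab(3) minv_mult mat_simps)
      moreover have "h \<cdot> a \<cdot> minv h \<in> ?C" using I ab(1) h by (rule congruence_full_conj)
      moreover have "h \<cdot> b \<cdot> minv h \<in> E" using ab(2) hx(1) by (intro E_closed(2,3))
      ultimately have "h \<cdot> s \<cdot> minv h \<in> S" unfolding S_def by blast
      then show "s \<in> H"
        using ab U unfolding H_def D_def by (auto intro: generate.incl)
    qed
    ultimately have "D \<subseteq> H"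
      unfolding D_def by (intro group.generate_subgroup_incl[OF GL_group])
    with hx show "h \<cdot> x \<cdot> minv h \<in> D" by (auto simp: H_def)
  qed
  moreover have "D \<subseteq> EI I"
  proof -
    have "a \<cdot> b \<cdot> minv a \<cdot> minv b \<in> EI I" if a: "a \<in> ?C" and b: "b \<in> E" for a b
    proof -
      note aU = CD(1)[OF a]
      \<comment> \<open>By [a, b c] = [a, b] b [a, c] b^-1 and the normality of E(n,I) in GL(n,R),
        these \<open>b\<close> form a subgroup, so only transvections have to be checked.\<close>
      define H where "H = {b \<in> Units M. a \<cdot> b \<cdot> minv a \<cdot> minv b \<in> EI I}"
      have "E \<subseteq> H"
        unfolding elementary_group_def
      proof (rule elementary_gen_minimal)
        show "subgroup H (GL n R)"
        proof (rule GL_subgroupI)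
          show "\<^bold>1 \<in> H" using aU EIc(1) by (simp add: H_def M.Units_closed)
        next
          fix b c assume bc: "b \<in> H" "c \<in> H"
          have "a \<cdot> (b \<cdot> c) \<cdot> minv a \<cdot> minv (b \<cdot> c) =
              (a \<cdot> b \<cdot> minv a \<cdot> minv b) \<cdot> (b \<cdot> (a \<cdot> c \<cdot> minv a \<cdot> minv c) \<cdot> minv b)"
            using aU bc by (simp add: H_def minv_mult mat_simps)
          also have "\<dots> \<in> EI I"
            using bc EIc(2) elementary_ideal_conj[OF I] unfolding H_def by blast
          finally show "b \<cdot> c \<in> H" using bc by (simp add: H_def)
        next
          fix b assume b: "b \<in> H"
          have "a \<cdot> minv b \<cdot> minv a \<cdot> minv (minv b) =
              minv b \<cdot> minv (a \<cdot> b \<cdot> minv a \<cdot> minv b) \<cdot> minv (minv b)"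
            using aU b by (simp add: H_def minv_mult mat_simps)
          also have "\<dots> \<in> EI I"
            using b EIc(3) elementary_ideal_conj[OF I] M.Units_inv_Units unfolding H_def by blast
          finally show "minv b \<in> H" using b by (simp add: H_def)
        qed (auto simp: H_def)
        fix i j r assume "i < n" "j < n" "i \<noteq> j" "r \<in> carrier R"
        then show "\<^bold>1 \<^bold>+ U i j r \<in> H"
          using commutator_in_elementary_ideal[OF I aU _ _ _ _ CD(3)[OF a]] transvection_unit
          by (simp add: H_def)
      qed
      with b show ?thesis by (auto simp: H_def)
    qed
    then have "S \<subseteq> EI I" unfolding S_def by blast
    then show ?thesis
      unfolding D_def using elementary_ideal(1)[OF IR]
      by (intro group.generate_subgroup_incl[OF GL_group])
  qed
  ultimately show ?thesis using \<open>commutator_subgroup (GL n R) ?C E = D\<close> by simp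
qed

end

section \<open>Extraction of transvections\<close>

text \<open>The situation that \<open>sandwich\<close> reaches by passing to a quotient
  ring.\<close>

locale transvection_free = matrix_ring R n
  for R (structure) and n :: nat +
  fixes G :: "'a mat set"
  assumes n: "n \<ge> 3"
    and G: "subgroup G (GL n R)"
    and G_conj: "t \<in> E \<Longrightarrow> g \<in> G \<Longrightarrow> t \<cdot> g \<cdot> minv t \<in> G"
    and no_transvection: "i < n \<Longrightarrow> j < n \<Longrightarrow> i \<noteq> j \<Longrightarrow> x \<in> carrier R \<Longrightarrow>
      \<^bold>1 \<^bold>+ U i j x \<in> G \<Longrightarrow> x = \<zero>"
begin

lemmas G_closed = GL_subgroupD[OF G]

lemma G_unit: "g \<in> G \<Longrightarrow> g \<in> Units M"
  using G_closed(1) by blast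

lemma commutator_in_G:
  assumes "g \<in> G" "t \<in> E"
  shows "g \<cdot> t \<cdot> minv g \<cdot> minv t \<in> G"
proof -
  have "g \<cdot> (t \<cdot> minv g \<cdot> minv t) \<in> G"
    using assms by (intro G_closed(3) G_conj G_closed(4))
  then show ?thesis
    using assms G_unit E_closed(4) by (simp add: M.m_assoc M.Units_closed)
qed

lemma conj_eq_oneD:
  assumes "t \<in> E" "A \<in> carrier M" "t \<cdot> A \<cdot> minv t = \<^bold>1"
  shows "A = \<^bold>1"
proof -
  have t: "t \<in> Units M" using assms(1) by (rule E_closed(4))
  have "A = minv t \<cdot> (t \<cdot> A \<cdot> minv t) \<cdot> t"
    using assms(2) t by (simp add: mat_simps)
  then show ?thesis using t by (simp add: assms(3))
qed

lemma commuting_if_commutator_one: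
  assumes "A \<in> Units M" "B \<in> Units M" "A \<cdot> B \<cdot> minv A \<cdot> minv B = \<^bold>1"
  shows "A \<cdot> B = B \<cdot> A"
proof -
  have "A \<cdot> B = A \<cdot> B \<cdot> minv A \<cdot> minv B \<cdot> (B \<cdot> A)"
    using assms(1,2) by (simp add: mat_simps)
  then show ?thesis using assms by (simp add: M.Units_closed)
qed

lemma fixed_row_minv:
  assumes "A \<in> Units M" "B \<in> carrier M" "B \<cdot> A = B"
  shows "B \<cdot> minv A = B"
proof -
  have "B \<cdot> A \<cdot> minv A = B" using assms(1,2) by (simp add: mat_simps)
  then show ?thesis using assms(3) by simp
qed

text \<open>For q \<noteq> p and a third index k, the commutator of t_kq(1) and 1 + \<Xi> is t_kp(x)
  with x the entry of \<Xi> at (q, p). It lies in \<open>G\<close>, so x = 0.\<close>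

lemma column_unipotent_trivial:
  assumes p: "p < n" and \<Xi>: "\<Xi> \<in> carrier M" "\<Xi> \<cdot> e p = \<Xi>" "e p \<cdot> \<Xi> = \<^bold>0" "\<^bold>1 \<^bold>+ \<Xi> \<in> G"
  shows "\<Xi> = \<^bold>0"
proof (rule mat_eqI)
  fix q l assume ql: "q < n" "l < n"
  have col: "\<Xi> $$ (q, l) = \<zero>" if "l \<noteq> p"
  proof -
    have "(\<Xi> \<cdot> e p) $$ (q, l) = \<Xi> $$ (q, l)" using \<Xi>(2) by simp
    then show ?thesis using that ql p \<Xi>(1) by simp
  qed
  have "\<Xi> $$ (q, p) = \<zero>"
  proof (cases "q = p")
    case True
    have "(e p \<cdot> \<Xi>) $$ (p, p) = \<zero>" using \<Xi>(3) p by simp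
    then show ?thesis using True p \<Xi>(1) by simp
  next
    case False
    obtain k where k: "k < n" "k \<noteq> p" "k \<noteq> q" using third_index[OF n] by blast
    define V where "V = U k q \<one>"
    have V: "V \<in> carrier M" by (simp add: V_def)
    have TE: "\<^bold>1 \<^bold>+ V \<in> E" using k ql by (simp add: V_def transvection_in_E)
    have TU: "minv (\<^bold>1 \<^bold>+ V) = \<^bold>1 \<^bold>- V" using k ql by (simp add: V_def transvection_unit)
    have "\<Xi> \<cdot> V = \<Xi> \<cdot> (e p \<cdot> V)" using \<Xi>(1,2) V by (simp add: M.m_assoc[symmetric])
    then have \<Xi>V: "\<Xi> \<cdot> V = \<^bold>0" using \<Xi>(1) k p by (simp add: V_def U_mult_U)
    have \<Xi>\<Xi>: "\<Xi> \<cdot> \<Xi> = \<^bold>0" using \<Xi> p by (metis M.m_assoc M.r_null e_closed)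
    have "(\<^bold>1 \<^bold>+ V) \<cdot> (\<^bold>1 \<^bold>+ \<Xi>) \<cdot> minv (\<^bold>1 \<^bold>+ V) \<cdot> minv (\<^bold>1 \<^bold>+ \<Xi>) \<in> G"
      using TE \<Xi>(4) by (intro G_closed(3,4) G_conj)
    also have "(\<^bold>1 \<^bold>+ V) \<cdot> (\<^bold>1 \<^bold>+ \<Xi>) \<cdot> minv (\<^bold>1 \<^bold>+ V) \<cdot> minv (\<^bold>1 \<^bold>+ \<Xi>) =
        (\<^bold>1 \<^bold>+ V) \<cdot> (\<^bold>1 \<^bold>+ \<Xi>) \<cdot> (\<^bold>1 \<^bold>- V) \<cdot> (\<^bold>1 \<^bold>- \<Xi>)"
      using M.one_plus_square_zero(2)[OF \<Xi>(1) \<Xi>\<Xi>] by (simp add: TU)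
    also have "\<dots> = \<^bold>1 \<^bold>+ V \<cdot> \<Xi>"
      using V \<Xi>(1) \<Xi>V \<Xi>\<Xi> k ql by (intro M.unipotent_commutator) (simp_all add: V_def U_mult_U)
    also have "V \<cdot> \<Xi> = U k p (\<Xi> $$ (q, p))"
    proof -
      have "V \<cdot> \<Xi> = V \<cdot> (\<Xi> \<cdot> e p)" using \<Xi>(2) by simp
      also have "\<dots> = U k p (\<Xi> $$ (q, p))" using \<Xi>(1) ql p by (simp add: V_def U_sandwich')
      finally show ?thesis .
    qed
    finally show ?thesis
      using no_transvection[of k p] k p ql \<Xi>(1) by simp
  qed
  then show "\<Xi> $$ (q, l) = \<^bold>0 $$ (q, l)" using col ql by (cases "l = p") auto
qed (use \<Xi> in auto)

text \<open>Row \<open>p\<close> of the inverse of \<open>h\<close> is trivial too, so with V = e_ip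
  the commutator of \<open>h\<close> and 1 + V is 1 + (h V - V), where h V - V lives in column
  \<open>p\<close> off the diagonal. By \<open>column_unipotent_trivial\<close> all columns i
  \<noteq> p of \<open>h\<close> are trivial; then h - 1 has the same shape and also
  vanishes.\<close>

lemma trivial_if_trivial_row:
  assumes h: "h \<in> G" and p: "p < n" and row: "e p \<cdot> h = e p"
  shows "h = \<^bold>1"
proof -
  have hU: "h \<in> Units M" using h by (rule G_unit)
  note hc = M.Units_closed[OF hU] M.Units_inv_closed[OF hU]
  have col: "h \<cdot> U i p \<one> = U i p \<one>" if i: "i < n" "i \<noteq> p" for i
  proof -
    define V where "V = U i p \<one>"
    have V: "V \<in> carrier M" "V \<cdot> V = \<^bold>0" "V \<cdot> e p = V" using i p by (simp_all add: V_def U_mult_U)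
    have TE: "\<^bold>1 \<^bold>+ V \<in> E" using i p by (simp add: V_def transvection_in_E)
    have TU: "minv (\<^bold>1 \<^bold>+ V) = \<^bold>1 \<^bold>- V" using i p by (simp add: V_def transvection_unit)
    have "V \<cdot> minv h = V \<cdot> (e p \<cdot> minv h)" using V hc by (simp add: M.m_assoc[symmetric])
    also have "\<dots> = V" using V fixed_row_minv[OF hU e_closed row] by simp
    finally have Vh: "V \<cdot> minv h = V" .
    have "h \<cdot> (\<^bold>1 \<^bold>+ V) \<cdot> minv h \<cdot> minv (\<^bold>1 \<^bold>+ V) \<in> G"
      using h TE by (rule commutator_in_G)
    also have "h \<cdot> (\<^bold>1 \<^bold>+ V) \<cdot> minv h = \<^bold>1 \<^bold>+ h \<cdot> V \<cdot> minv h"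
      using hU V(1) by (rule M.conj_one_plus)
    also have "h \<cdot> V \<cdot> minv h = h \<cdot> V"
      using V hc by (simp add: M.m_assoc Vh)
    also have "(\<^bold>1 \<^bold>+ h \<cdot> V) \<cdot> minv (\<^bold>1 \<^bold>+ V) = \<^bold>1 \<^bold>+ (h \<cdot> V \<^bold>- V) \<^bold>- h \<cdot> (V \<cdot> V)"
      unfolding TU using hc(1) V(1) by algebra
    also have "\<dots> = \<^bold>1 \<^bold>+ (h \<cdot> V \<^bold>- V)" using hc V by (simp add: M.minus_eq)
    finally have 1: "\<^bold>1 \<^bold>+ (h \<cdot> V \<^bold>- V) \<in> G" .
    have "e p \<cdot> V = \<^bold>0" using i p by (simp add: V_def U_mult_U)
    moreover have "e p \<cdot> (h \<cdot> V) = e p \<cdot> V" using hc V row by (simp add: M.m_assoc[symmetric])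
    ultimately have 2: "e p \<cdot> (h \<cdot> V \<^bold>- V) = \<^bold>0"
      using hc V by (simp add: M.minus_eq M.r_distr M.r_minus)
    have 3: "(h \<cdot> V \<^bold>- V) \<cdot> e p = h \<cdot> V \<^bold>- V"
      using hc V by (simp add: M.minus_eq M.l_distr M.l_minus M.m_assoc)
    have "h \<cdot> V \<^bold>- V = \<^bold>0"
      using hc V by (intro column_unipotent_trivial[OF p _ 3 2 1]) simp
    then show ?thesis using hc V by (simp add: M.minus_eq_zero_iff V_def)
  qed
  have "h \<^bold>- \<^bold>1 = \<^bold>0"
  proof (rule column_unipotent_trivial[OF p])
    show "\<^bold>1 \<^bold>+ (h \<^bold>- \<^bold>1) \<in> G"
    proof -
      have "\<^bold>1 \<^bold>+ (h \<^bold>- \<^bold>1) = h" using hc(1) by algebra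
      then show ?thesis using h by simp
    qed
    show "e p \<cdot> (h \<^bold>- \<^bold>1) = \<^bold>0"
      using hc row by (simp add: M.minus_eq M.r_distr M.r_minus M.r_neg)
    show "(h \<^bold>- \<^bold>1) \<cdot> e p = h \<^bold>- \<^bold>1"
    proof (rule mat_eqI)
      fix i j assume ij: "i < n" "j < n"
      show "((h \<^bold>- \<^bold>1) \<cdot> e p) $$ (i, j) = (h \<^bold>- \<^bold>1) $$ (i, j)"
      proof (cases "j = p")
        case False
        have "(h \<cdot> U j p \<one>) $$ (i, p) = U j p \<one> $$ (i, p)" using col[OF ij(2) False] by simp
        then have "h $$ (i, j) = (if i = j then \<one> else \<zero>)" using hc ij p by simp
        then show ?thesis using False ij p hc by (simp add: minus_eq r_neg)
      qed (use ij hc p in simp)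
    qed (use hc in auto)
  qed (use hc in auto)
  then show ?thesis using hc by (simp add: M.minus_eq_zero_iff)
qed

text \<open>For V = d e_ik and a third index \<open>p\<close>, a row operation \<open>L\<close>
  makes row \<open>p\<close> of L g V vanish. Then the commutator of \<open>g\<close> and 1 + V,
  conjugated by \<open>L\<close>, has a trivial row \<open>p\<close> and so is 1. Thus
  \<open>g\<close> commutes with V, and the (k, k) entries give g_ki d = 0.\<close>

lemma off_diagonal_trivial:
  assumes g: "g \<in> G" and ik: "i < n" "k < n" "k \<noteq> i"
    and d: "d \<in> carrier R" "m \<in> carrier R" "m \<otimes> g $$ (k, i) \<otimes> d = d"
  shows "d = \<zero>"
proof -
  obtain p where p: "p < n" "p \<noteq> i" "p \<noteq> k" using third_index[OF n] by blast
  have gU: "g \<in> Units M" using g by (rule G_unit)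
  note gc = M.Units_closed[OF gU] M.Units_inv_closed[OF gU]
  define s where "s = g $$ (p, i) \<otimes> m"
  have s: "s \<in> carrier R" using gc ik p d by (simp add: s_def)
  have sd: "s \<otimes> g $$ (k, i) \<otimes> d = g $$ (p, i) \<otimes> d"
    using gc ik p d by (simp add: s_def m_assoc)
  define L where "L = \<^bold>1 \<^bold>+ U p k (\<ominus> s)"
  have L: "L \<in> E" using p ik s by (simp add: L_def transvection_in_E)
  then have LU: "L \<in> Units M" by (rule E_closed(4))
  note Lc = M.Units_closed[OF LU] M.Units_inv_closed[OF LU]
  define V where "V = U i k d"
  have V: "V \<in> carrier M" using d by (simp add: V_def)
  have TE: "\<^bold>1 \<^bold>+ V \<in> E" using ik d by (simp add: V_def transvection_in_E)
  have TU: "minv (\<^bold>1 \<^bold>+ V) = \<^bold>1 \<^bold>- V" "\<^bold>1 \<^bold>+ V \<in> Units M"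
    using ik d by (simp_all add: V_def transvection_unit)
  define c where "c = g \<cdot> (\<^bold>1 \<^bold>+ V) \<cdot> minv g \<cdot> minv (\<^bold>1 \<^bold>+ V)"
  have c: "c \<in> G" unfolding c_def using g TE by (rule commutator_in_G)
  then have cc: "c \<in> carrier M" using G_unit by blast
  have eL: "e p \<cdot> L = e p \<^bold>- U p k s"
    using p ik s by (simp add: L_def M.r_distr U_mult_U U_uminus M.r_minus M.minus_eq)
  have "e p \<cdot> L \<cdot> (g \<cdot> V) = \<^bold>0"
    using gc p ik s d sd unfolding eL V_def
    by (simp add: M.minus_eq M.l_distr M.l_minus U_sandwich' M.r_neg)
  then have 1: "e p \<cdot> L \<cdot> (g \<cdot> V \<cdot> minv g) = \<^bold>0"
    using gc Lc V by (simp add: M.m_assoc[symmetric])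
  have 2: "e p \<cdot> L \<cdot> V = \<^bold>0"
    using p ik s d unfolding eL V_def by (simp add: M.minus_eq M.l_distr M.l_minus U_mult_U)
  have "c = (\<^bold>1 \<^bold>+ g \<cdot> V \<cdot> minv g) \<cdot> (\<^bold>1 \<^bold>- V)"
    using gU V by (simp add: c_def TU M.conj_one_plus)
  then have "e p \<cdot> L \<cdot> c = (e p \<cdot> L \<^bold>+ e p \<cdot> L \<cdot> (g \<cdot> V \<cdot> minv g)) \<cdot> (\<^bold>1 \<^bold>- V)"
    using gc Lc V by (simp add: M.m_assoc[symmetric] M.r_distr)
  also have "\<dots> = e p \<cdot> L"
    unfolding 1 using Lc V 2 by (simp add: M.minus_eq M.r_distr M.r_minus)
  finally have epLc: "e p \<cdot> L \<cdot> c = e p \<cdot> L" .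
  have "e p \<cdot> (L \<cdot> c \<cdot> minv L) = e p \<cdot> L \<cdot> c \<cdot> minv L"
    using Lc cc by (simp add: M.m_assoc)
  also have "\<dots> = e p"
    unfolding epLc using LU by (simp add: mat_simps)
  finally have "e p \<cdot> (L \<cdot> c \<cdot> minv L) = e p" .
  then have "L \<cdot> c \<cdot> minv L = \<^bold>1"
    using G_conj[OF L c] p(1) by (intro trivial_if_trivial_row)
  then have "c = \<^bold>1" by (rule conj_eq_oneD[OF L cc])
  then have "g \<cdot> (\<^bold>1 \<^bold>+ V) = (\<^bold>1 \<^bold>+ V) \<cdot> g"
    using gU TU(2) by (intro commuting_if_commutator_one) (simp_all add: c_def)
  then have "g \<cdot> V = V \<cdot> g"
    using gc V by (simp add: M.r_distr M.l_distr M.a_left_cancel)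
  then have "(g \<cdot> V) $$ (k, k) = (V \<cdot> g) $$ (k, k)" by simp
  then have "g $$ (k, i) \<otimes> d = \<zero>"
    using gc ik d by (simp add: V_def)
  then show ?thesis
    using d gc ik by (metis m_assoc r_null entry_closed)
qed

text \<open>The row operation now uses row \<open>i\<close>, and \<open>L\<close> need not commute
  with \<open>V\<close>: of the two factors of h = A B, only \<open>A\<close> is known to have a
  trivial row \<open>k\<close>. Commutators with two further transvections \<open>T\<close> and
  \<open>T'\<close> first determine the shape of \<open>X\<close> and then show that its row
  \<open>j\<close> is zero.\<close>

lemma diagonal_splitting_trivial:
  assumes g: "g \<in> G" and ij: "i < n" "j < n" "i \<noteq> j"
    and d: "d \<in> carrier R" "m \<in> carrier R" "m \<otimes> g $$ (i, i) \<otimes> d = d"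
  shows "g $$ (j, i) \<otimes> d = \<zero>"
proof -
  obtain k where k: "k < n" "k \<noteq> i" "k \<noteq> j" using third_index[OF n] by blast
  have gU: "g \<in> Units M" using g by (rule G_unit)
  note gc = M.Units_closed[OF gU] M.Units_inv_closed[OF gU]
  define s where "s = g $$ (k, i) \<otimes> m"
  have s: "s \<in> carrier R" using gc ij k d by (simp add: s_def)
  have sd: "s \<otimes> g $$ (i, i) \<otimes> d = g $$ (k, i) \<otimes> d"
    using gc ij k d by (simp add: s_def m_assoc)
  define L where "L = \<^bold>1 \<^bold>+ U k i (\<ominus> s)"
  have L: "L \<in> E" using k ij s by (simp add: L_def transvection_in_E)
  then have LU: "L \<in> Units M" by (rule E_closed(4))
  note Lc = M.Units_closed[OF LU] M.Units_inv_closed[OF LU]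
  have Linv: "minv L = \<^bold>1 \<^bold>+ U k i s"
    using k ij s transvection_unit(2)[of k i "\<ominus> s"]
    unfolding L_def by (simp add: M.minus_eq U_uminus[symmetric])
  define V where "V = U i j d"
  have V: "V \<in> carrier M" using d by (simp add: V_def)
  have TE: "\<^bold>1 \<^bold>+ V \<in> E" using ij d by (simp add: V_def transvection_in_E)
  have TU: "minv (\<^bold>1 \<^bold>+ V) = \<^bold>1 \<^bold>- V" "\<^bold>1 \<^bold>+ V \<in> Units M"
    using ij d by (simp_all add: V_def transvection_unit)
  define X where "X = L \<cdot> (g \<cdot> V \<cdot> minv g) \<cdot> minv L"
  define Y where "Y = U i j d \<^bold>- U k j (s \<otimes> d)"
  define A B where "A = \<^bold>1 \<^bold>+ X" and "B = \<^bold>1 \<^bold>- Y"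
  have XY: "X \<in> carrier M" "Y \<in> carrier M" using Lc gc V d s by (simp_all add: X_def Y_def)
  have AB: "A \<in> carrier M" "B \<in> carrier M" using XY by (simp_all add: A_def B_def)
  have A': "A = L \<cdot> (g \<cdot> (\<^bold>1 \<^bold>+ V) \<cdot> minv g) \<cdot> minv L"
    using LU gU V gc by (simp add: A_def X_def M.conj_one_plus)
  have AU: "A \<in> Units M" unfolding A' using LU gU TU by (intro M.Units_m_closed M.Units_inv_Units)
  have "L \<cdot> V = Y"
    using k ij s d unfolding L_def V_def Y_def
    by (simp add: M.l_distr U_mult_U U_uminus M.l_minus M.minus_eq)
  moreover have "Y \<cdot> minv L = Y"
    using k ij s d unfolding Linv Y_def
    by (simp add: M.l_distr M.r_distr U_mult_U M.l_minus M.minus_eq)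
  ultimately have "L \<cdot> V \<cdot> minv L = Y" by simp
  then have B': "B = L \<cdot> minv (\<^bold>1 \<^bold>+ V) \<cdot> minv L"
    using LU Lc V by (simp add: TU B_def M.minus_eq M.r_distr M.l_distr M.r_minus M.l_minus)
  define h where "h = L \<cdot> (g \<cdot> (\<^bold>1 \<^bold>+ V) \<cdot> minv g \<cdot> minv (\<^bold>1 \<^bold>+ V)) \<cdot> minv L"
  have h: "h \<in> G" unfolding h_def using L g TE by (intro G_conj commutator_in_G)
  then have hU: "h \<in> Units M" by (rule G_unit)
  have hAB: "h = A \<cdot> B"
    unfolding h_def A' B' using LU gU TU(2) by (simp add: mat_simps)
  have ekX: "e k \<cdot> X = \<^bold>0"
  proof -
    have "e k \<cdot> L = e k \<^bold>- U k i s"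
      using k ij s by (simp add: L_def M.r_distr U_mult_U U_uminus M.r_minus M.minus_eq)
    then have "e k \<cdot> L \<cdot> (g \<cdot> V) = \<^bold>0"
      using gc k ij s d sd unfolding V_def
      by (simp add: M.minus_eq M.l_distr M.l_minus U_sandwich' M.r_neg)
    then show ?thesis using gc Lc V by (simp add: X_def M.m_assoc[symmetric])
  qed
  have ekA: "e k \<cdot> A = e k" using XY ekX by (simp add: A_def M.r_distr)
  \<comment> \<open>\<open>T\<close> commutes with \<open>B\<close>, so [h, T] = [A, T]. This lies
    in \<open>G\<close>, and its row \<open>k\<close> is trivial because those of \<open>A\<close>
    and \<open>T\<close> are.\<close>
  define T where "T = \<^bold>1 \<^bold>+ U i j \<one>"
  have T: "T \<in> E" "T \<in> Units M" "minv T = \<^bold>1 \<^bold>- U i j \<one>"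
    using ij by (simp_all add: T_def transvection_in_E transvection_unit)
  have "Y \<cdot> U i j \<one> = \<^bold>0" "U i j \<one> \<cdot> Y = \<^bold>0"
    using k ij s d by (simp_all add: Y_def M.minus_eq M.l_distr M.r_distr M.l_minus M.r_minus U_mult_U)
  then have BT: "B \<cdot> T = T \<cdot> B"
    using XY by (simp add: B_def T_def M.minus_eq M.l_distr M.r_distr M.l_minus M.r_minus M.a_ac)
  have hT: "h \<cdot> T \<cdot> minv h \<cdot> minv T = A \<cdot> T \<cdot> minv A \<cdot> minv T"
  proof -
    have "h \<cdot> T = A \<cdot> (T \<cdot> B)" unfolding hAB using AB T BT by (simp add: M.m_assoc M.Units_closed)
    also have "\<dots> = A \<cdot> T \<cdot> minv A \<cdot> h" unfolding hAB using AB AU T by (simp add: mat_simps)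
    finally show ?thesis using AU T hU by (simp add: mat_simps)
  qed
  have "A \<cdot> T = T \<cdot> A"
  proof (rule commuting_if_commutator_one[OF AU T(2)])
    have "e k \<cdot> T = e k" using k ij by (simp add: T_def M.r_distr U_mult_U)
    then have row: "e k \<cdot> T = e k" "e k \<cdot> minv T = e k" "e k \<cdot> minv A = e k"
      using T(2) AU ekA by (auto intro!: fixed_row_minv)
    have "e k \<cdot> (A \<cdot> T \<cdot> minv A \<cdot> minv T) = e k \<cdot> A \<cdot> T \<cdot> minv A \<cdot> minv T"
      using AU T(2) by (simp add: M.m_assoc M.Units_closed)
    also have "\<dots> = e k" by (simp add: ekA row)
    finally show "A \<cdot> T \<cdot> minv A \<cdot> minv T = \<^bold>1"
      using commutator_in_G[OF h T(1)] k(1) unfolding hT by (intro trivial_if_trivial_row)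
  qed
  then have XV: "X \<cdot> U i j \<one> = U i j \<one> \<cdot> X"
    using XY by (simp add: A_def T_def M.l_distr M.r_distr M.a_assoc M.a_left_cancel M.a_lcomm[of "U i j \<one>"])
  \<comment> \<open>Commuting with e_ij forces column \<open>i\<close> and row \<open>j\<close> of
    \<open>X\<close> to vanish off the diagonal and the diagonal entries at \<open>i\<close> and
    \<open>j\<close> to agree.\<close>
  have ent: "(X \<cdot> U i j \<one>) $$ (p, l) = (U i j \<one> \<cdot> X) $$ (p, l)" for p l using XV by simp
  have X1: "X $$ (p, i) = \<zero>" if "p < n" "p \<noteq> i" for p
    using ent[of p j] that ij XY by simp
  have X2: "X $$ (j, l) = \<zero>" if "l < n" "l \<noteq> j" for l
    using ent[of i l] that ij XY by simp
  have X3: "X $$ (i, i) = X $$ (j, j)"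
    using ent[of i j] ij XY by simp
  define \<beta> where "\<beta> = X $$ (i, i)"
  have \<beta>: "\<beta> \<in> carrier R" using XY ij by (simp add: \<beta>_def)
  have "X \<cdot> e i = U i i \<beta>"
    using XY ij X1 \<beta> by (intro mat_eqI) (auto simp: \<beta>_def)
  moreover have "Y \<cdot> e i = \<^bold>0"
    using k ij s d by (simp add: Y_def M.minus_eq M.l_distr M.l_minus U_mult_U)
  ultimately have hei: "h \<cdot> e i = e i \<^bold>+ U i i \<beta>"
    using XY \<beta> unfolding hAB A_def B_def
    by (simp add: M.m_assoc M.minus_eq M.l_distr M.r_distr M.l_minus M.r_minus)
  have ejh: "e j \<cdot> (h \<cdot> e i) = \<^bold>0"
    using hei ij \<beta> by (simp add: M.r_distr U_mult_U)
  \<comment> \<open>Column \<open>i\<close> of \<open>h\<close> is zero in row \<open>j\<close>, so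
    [h, T'] has a trivial row \<open>j\<close> and \<open>h\<close> commutes with \<open>T'\<close>.
    The (i, k) entries then give 1 + \<beta> = h_ii = h_kk = 1.\<close>
  define T' where "T' = \<^bold>1 \<^bold>+ U i k \<one>"
  have T': "T' \<in> E" "T' \<in> Units M"
    using ij k by (simp_all add: T'_def transvection_in_E transvection_unit)
  have hT': "h \<cdot> T' = T' \<cdot> h"
  proof (rule commuting_if_commutator_one[OF hU T'(2)])
    have "e j \<cdot> (h \<cdot> U i k \<one>) = e j \<cdot> (h \<cdot> e i) \<cdot> U i k \<one>"
      using hU ij by (simp add: M.m_assoc U_mult_U M.Units_closed)
    then have "e j \<cdot> (h \<cdot> U i k \<one>) = \<^bold>0" by (simp add: ejh)
    then have "e j \<cdot> (h \<cdot> T') = e j \<cdot> h"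
      using hU by (simp add: T'_def M.r_distr M.Units_closed)
    then have "e j \<cdot> (h \<cdot> T' \<cdot> minv h \<cdot> minv T') = e j \<cdot> minv T'"
      using hU T'(2) by (simp add: M.m_assoc[symmetric] M.Units_closed) (simp add: M.m_assoc M.Units_closed)
    also have "e j \<cdot> T' = e j" using ij by (simp add: T'_def M.r_distr U_mult_U)
    then have "e j \<cdot> minv T' = e j" using T' by (intro fixed_row_minv) simp_all
    finally show "h \<cdot> T' \<cdot> minv h \<cdot> minv T' = \<^bold>1"
      using commutator_in_G[OF h T'(1)] ij by (intro trivial_if_trivial_row)
  qed
  then have "h \<cdot> U i k \<one> = U i k \<one> \<cdot> h"
    using hU by (simp add: T'_def M.l_distr M.r_distr M.a_left_cancel M.Units_closed)
  then have "(h \<cdot> U i k \<one>) $$ (i, k) = (U i k \<one> \<cdot> h) $$ (i, k)" by simp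
  then have hh: "h $$ (i, i) = h $$ (k, k)" using hU ij k by (simp add: M.Units_closed)
  have "(h \<cdot> e i) $$ (i, i) = \<one> \<oplus> \<beta>" unfolding hei using ij \<beta> by simp
  then have h1: "h $$ (i, i) = \<one> \<oplus> \<beta>" using hU ij by (simp add: M.Units_closed)
  have "e k \<cdot> h = e k \<cdot> B"
    unfolding hAB using AB ekA by (simp add: M.m_assoc[symmetric])
  then have "(e k \<cdot> h) $$ (k, k) = (e k \<cdot> B) $$ (k, k)" by simp
  then have "h $$ (k, k) = B $$ (k, k)" using hU AB k by (simp add: M.Units_closed)
  also have "\<dots> = \<one>"
    using k ij s d by (simp add: B_def Y_def minus_eq)
  finally have "\<one> \<oplus> \<beta> = \<one> \<oplus> \<zero>" using hh h1 by simp
  then have \<beta>0: "\<beta> = \<zero>" using \<beta> by (simp only: a_left_cancel one_closed zero_closed)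
  \<comment> \<open>Undoing the conjugations in \<open>X\<close> leaves row \<open>j\<close> of g V,
    since \<open>L\<close> does not alter row \<open>j\<close>.\<close>
  have "e j \<cdot> X = \<^bold>0"
    using XY X2 X3 \<beta>0 ij by (intro mat_eqI) (auto simp: \<beta>_def)
  then have "e j \<cdot> X \<cdot> L \<cdot> g = \<^bold>0" using Lc gc by simp
  then have "e j \<cdot> L \<cdot> (g \<cdot> V) = \<^bold>0"
    using LU gU V unfolding X_def by (simp add: mat_simps)
  moreover have "e j \<cdot> L = e j"
    using k ij s by (simp add: L_def M.r_distr U_mult_U)
  ultimately have "e j \<cdot> (g \<cdot> V) = \<^bold>0" by simp
  then have "(e j \<cdot> (g \<cdot> V)) $$ (j, j) = \<zero>" using ij by simp
  then show ?thesis using gc V ij d by (simp add: V_def)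
qed

end

section \<open>Over a splitting ring: from radical entries to central matrices\<close>

locale splitting_transvection_free = transvection_free R n G + splitting_ring R
  for R (structure) and n and G
begin

text \<open>In a splitting for a = x g_ki the summand d1 vanishes by
  \<open>off_diagonal_trivial\<close>, so d2 = 1 and m2 (1 - a) = 1. For all \<open>x\<close>
  together this is membership of g_ki in the Jacobson radical.\<close>

lemma off_diagonal_radical:
  assumes g: "g \<in> G" and ik: "i < n" "k < n" "k \<noteq> i" and x: "x \<in> carrier R"
  shows "\<exists>p\<in>carrier R. p \<otimes> (\<one> \<ominus> x \<otimes> g $$ (k, i)) = \<one>"
proof -
  have gki: "g $$ (k, i) \<in> carrier R" using g ik G_unit by blast
  define a where "a = x \<otimes> g $$ (k, i)"
  have a: "a \<in> carrier R" using x gki by (simp add: a_def)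
  obtain d1 d2 m1 m2 where d: "d1 \<in> carrier R" "d2 \<in> carrier R" "m1 \<in> carrier R" "m2 \<in> carrier R"
    "d1 \<oplus> d2 = \<one>" "m1 \<otimes> a \<otimes> d1 = d1" "m2 \<otimes> (\<one> \<ominus> a) \<otimes> d2 = d2"
    using splitting[OF a] by blast
  have "d1 = \<zero>"
  proof (rule off_diagonal_trivial[OF g ik d(1)])
    show "m1 \<otimes> x \<in> carrier R" using d x by simp
    show "m1 \<otimes> x \<otimes> g $$ (k, i) \<otimes> d1 = d1" using d x gki by (simp add: a_def m_assoc)
  qed
  then have "d2 = \<one>" using d by simp
  then show ?thesis using d a by (auto simp: a_def intro!: bexI[of _ m2])
qed

lemma off_diagonal_zero:
  assumes g: "g \<in> G" and ij: "i < n" "j < n" "i \<noteq> j"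
  shows "g $$ (j, i) = \<zero>"
proof -
  have gU: "g \<in> Units M" using g by (rule G_unit)
  note gc = M.Units_closed[OF gU] M.Units_inv_closed[OF gU]
  define f where "f k = minv g $$ (i, k) \<otimes> g $$ (k, i)" for k
  have f: "f k \<in> carrier R" if "k < n" for k using that ij gc by (simp add: f_def)
  \<comment> \<open>The radical is closed under sums: if p (1 - x \<sigma>) = 1, then p (1 - x (f k
    + \<sigma>)) = 1 - p x f k, which is again left invertible.\<close>
  have rad: "\<exists>p\<in>carrier R. p \<otimes> (\<one> \<ominus> x \<otimes> (\<Oplus>k\<in>S. f k)) = \<one>"
    if "finite S" "S \<subseteq> {..<n} - {i}" "x \<in> carrier R" for S x
    using that
  proof (induction S rule: finite_induct)
    case empty
    then show ?case by (auto simp: minus_eq intro!: bexI[of _ \<one>])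
  next
    case (insert k S)
    define \<sigma> where "\<sigma> = (\<Oplus>k\<in>S. f k)"
    have \<sigma>: "\<sigma> \<in> carrier R" unfolding \<sigma>_def using insert f by (intro finsum_closed) auto
    have k: "k < n" "k \<noteq> i" using insert by auto
    obtain p where p: "p \<in> carrier R" "p \<otimes> (\<one> \<ominus> x \<otimes> \<sigma>) = \<one>"
      using insert unfolding \<sigma>_def by auto
    have w: "minv g $$ (i, k) \<in> carrier R" "g $$ (k, i) \<in> carrier R" using gc ij k by auto
    obtain p' where p': "p' \<in> carrier R" "p' \<otimes> (\<one> \<ominus> p \<otimes> x \<otimes> minv g $$ (i, k) \<otimes> g $$ (k, i)) = \<one>"
      using off_diagonal_radical[OF g ij(1) k, of "p \<otimes> x \<otimes> minv g $$ (i, k)"] p w insert by auto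
    have "(\<Oplus>k\<in>insert k S. f k) = f k \<oplus> \<sigma>"
      unfolding \<sigma>_def using insert f by (intro finsum_insert) auto
    moreover have "p' \<otimes> p \<otimes> (\<one> \<ominus> x \<otimes> (f k \<oplus> \<sigma>)) = \<one>"
    proof -
      have "p \<otimes> (\<one> \<ominus> x \<otimes> (f k \<oplus> \<sigma>)) = p \<otimes> (\<one> \<ominus> x \<otimes> \<sigma>) \<ominus> p \<otimes> x \<otimes> f k"
        using p(1) \<sigma> insert.prems(2) f[OF k(1)] by algebra
      also have "\<dots> = \<one> \<ominus> p \<otimes> x \<otimes> minv g $$ (i, k) \<otimes> g $$ (k, i)"
        using p w insert.prems by (simp add: f_def m_assoc)
      finally show ?thesis
        using p(1) p' \<sigma> insert.prems(2) f[OF k(1)] by (simp add: m_assoc)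
    qed
    ultimately show ?case using p p' by (auto intro!: bexI[of _ "p' \<otimes> p"])
  qed
  \<comment> \<open>The summands \<open>f k\<close> add up to 1, so \<open>f i\<close> is 1 minus an
    element of the radical and hence left invertible.\<close>
  have "(minv g \<cdot> g) $$ (i, i) = \<one>" using gU ij by simp
  then have "(\<Oplus>k\<in>{..<n}. f k) = \<one>"
    using ij by (subst (asm) entry_mult) (simp_all add: f_def)
  moreover have "(\<Oplus>k\<in>{..<n}. f k) = f i \<oplus> (\<Oplus>k\<in>{..<n} - {i}. f k)"
  proof -
    have "(\<Oplus>k\<in>insert i ({..<n} - {i}). f k) = f i \<oplus> (\<Oplus>k\<in>{..<n} - {i}. f k)"
      using f ij by (intro finsum_insert) auto
    then show ?thesis using ij by (simp add: insert_absorb)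
  qed
  moreover have \<sigma>: "(\<Oplus>k\<in>{..<n} - {i}. f k) \<in> carrier R" using f by (intro finsum_closed) auto
  ultimately have fi: "f i = \<one> \<ominus> \<one> \<otimes> (\<Oplus>k\<in>{..<n} - {i}. f k)"
    using f[OF ij(1)] by (simp add: minus_eq) (metis a_assoc r_neg r_zero a_inv_closed)
  obtain p where p: "p \<in> carrier R" "p \<otimes> f i = \<one>"
    using rad[of "{..<n} - {i}" \<one>] fi by auto
  \<comment> \<open>With g_ii left invertible, \<open>diagonal_splitting_trivial\<close> applies to
    d = 1.\<close>
  have "g $$ (j, i) \<otimes> \<one> = \<zero>"
  proof (rule diagonal_splitting_trivial[OF g ij one_closed])
    show "p \<otimes> minv g $$ (i, i) \<in> carrier R" using p gc ij by simp
    show "p \<otimes> minv g $$ (i, i) \<otimes> g $$ (i, i) \<otimes> \<one> = \<one>"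
      using p gc ij by (simp add: f_def m_assoc)
  qed
  then show ?thesis using gc ij by simp
qed

text \<open>The conjugate of \<open>g\<close> by t_ij(r) is again in \<open>G\<close>, so its (i, j)
  entry r g_jj - g_ii r is zero. Taking r = 1 shows that all diagonal entries agree; so
  \<open>g\<close> is a scalar matrix with central entry.\<close>

lemma central:
  assumes g: "g \<in> G" and H: "H \<in> carrier M"
  shows "g \<cdot> H = H \<cdot> g"
proof -
  have gU: "g \<in> Units M" using g by (rule G_unit)
  note gc = M.Units_closed[OF gU] M.Units_inv_closed[OF gU]
  have tw: "r \<otimes> g $$ (j, j) = g $$ (i, i) \<otimes> r"
    if ij: "i < n" "j < n" "i \<noteq> j" and r: "r \<in> carrier R" for i j r
  proof -
    define V where "V = U i j r"
    have V: "V \<in> carrier M" using r by (simp add: V_def)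
    have "(\<^bold>1 \<^bold>+ V) \<cdot> g \<cdot> minv (\<^bold>1 \<^bold>+ V) \<in> G"
      using g ij r by (intro G_conj) (simp_all add: V_def transvection_in_E)
    then have "((\<^bold>1 \<^bold>+ V) \<cdot> g \<cdot> (\<^bold>1 \<^bold>- V)) $$ (i, j) = \<zero>"
      using off_diagonal_zero[of _ j i] ij r by (simp add: V_def transvection_unit)
    moreover have "(\<^bold>1 \<^bold>+ V) \<cdot> g \<cdot> (\<^bold>1 \<^bold>- V) = g \<^bold>+ V \<cdot> g \<^bold>- g \<cdot> V \<^bold>- V \<cdot> (g \<cdot> V)"
      using gc(1) V by algebra
    ultimately show ?thesis
      using gc V r ij off_diagonal_zero[OF g ij(2,1)] off_diagonal_zero[OF g ij(1,2)]
      by (simp add: V_def U_sandwich' minus_eq_zero_iff minus_eq[symmetric])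
  qed
  have diag: "g $$ (i, i) = g $$ (j, j)" if "i < n" "j < n" for i j
    using tw[of i j \<one>] that gc by (cases "i = j") simp_all
  have comm: "g $$ (i, i) \<otimes> r = r \<otimes> g $$ (j, j)" if "i < n" "j < n" "r \<in> carrier R" for i j r
  proof -
    \<comment> \<open>Going through another index covers the case i = j, which \<open>tw\<close>
      excludes.\<close>
    obtain k where k: "k < n" "k \<noteq> i" using third_index[OF n] by blast
    then have "g $$ (i, i) \<otimes> r = r \<otimes> g $$ (k, k)" using tw[of i k r] that by simp
    then show ?thesis using diag[of k j] k that by simp
  qed
  show ?thesis
  proof (rule mat_eqI)
    fix i j assume ij: "i < n" "j < n"
    have "(g \<cdot> H) $$ (i, j) = g $$ (i, i) \<otimes> H $$ (i, j)"
      using ij gc H off_diagonal_zero[OF g]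
      by (subst entry_mult, simp, simp, subst finsum_delta[where i = i]) auto
    also have "\<dots> = H $$ (i, j) \<otimes> g $$ (j, j)" using comm[OF ij, of "H $$ (i, j)"] ij H by simp
    also have "\<dots> = (H \<cdot> g) $$ (i, j)"
      using ij gc H off_diagonal_zero[OF g]
      by (subst entry_mult, simp, simp, subst finsum_delta[where i = j]) auto
    finally show "(g \<cdot> H) $$ (i, j) = (H \<cdot> g) $$ (i, j)" .
  qed (use gc H in auto)
qed

end

section \<open>Passage to the quotient ring and the sandwich condition\<close>

lemma quotient_representative:
  assumes "s \<in> carrier (R Quot I)"
  shows "\<exists>r\<in>carrier R. s = I +>\<^bsub>R\<^esub> r"
  using assms unfolding FactRing_def A_RCOSETS_def' by simp

lemma (in splitting_ring) splitting_quotient: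
  assumes "ideal I R"
  shows "splitting_ring (R Quot I)"
proof -
  interpret I: ideal I R by fact
  interpret F: ring_hom_ring R "R Quot I" "(+>) I" by (rule I.rcos_ring_hom_ring)
  show ?thesis
  proof (intro splitting_ring.intro splitting_ring_axioms.intro)
    show "ring (R Quot I)" by (rule I.quotient_is_ring)
    fix a' assume "a' \<in> carrier (R Quot I)"
    then obtain a where a: "a \<in> carrier R" "a' = I +> a"
      using quotient_representative by blast
    obtain d1 d2 m1 m2 where d: "d1 \<in> carrier R" "d2 \<in> carrier R" "m1 \<in> carrier R" "m2 \<in> carrier R"
      "d1 \<oplus> d2 = \<one>" "m1 \<otimes> a \<otimes> d1 = d1" "m2 \<otimes> (\<one> \<ominus> a) \<otimes> d2 = d2"
      using splitting[OF a(1)] by blast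
    let ?h = "(+>) I"
    have "?h (d1 \<oplus> d2) = ?h \<one>" "?h (m1 \<otimes> a \<otimes> d1) = ?h d1" "?h (m2 \<otimes> (\<one> \<ominus> a) \<otimes> d2) = ?h d2"
      unfolding d by simp_all
    then have "?h d1 \<oplus>\<^bsub>R Quot I\<^esub> ?h d2 = \<one>\<^bsub>R Quot I\<^esub>"
      "?h m1 \<otimes>\<^bsub>R Quot I\<^esub> a' \<otimes>\<^bsub>R Quot I\<^esub> ?h d1 = ?h d1"
      "?h m2 \<otimes>\<^bsub>R Quot I\<^esub> (\<one>\<^bsub>R Quot I\<^esub> \<ominus>\<^bsub>R Quot I\<^esub> a') \<otimes>\<^bsub>R Quot I\<^esub> ?h d2 = ?h d2"
      using a d(1-4) by (simp_all add: minus_eq F.S.minus_eq)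
    then show "\<exists>d\<^sub>1\<in>carrier (R Quot I). \<exists>d\<^sub>2\<in>carrier (R Quot I).
        \<exists>m\<^sub>1\<in>carrier (R Quot I). \<exists>m\<^sub>2\<in>carrier (R Quot I).
        d\<^sub>1 \<oplus>\<^bsub>R Quot I\<^esub> d\<^sub>2 = \<one>\<^bsub>R Quot I\<^esub> \<and>
        m\<^sub>1 \<otimes>\<^bsub>R Quot I\<^esub> a' \<otimes>\<^bsub>R Quot I\<^esub> d\<^sub>1 = d\<^sub>1 \<and>
        m\<^sub>2 \<otimes>\<^bsub>R Quot I\<^esub> (\<one>\<^bsub>R Quot I\<^esub> \<ominus>\<^bsub>R Quot I\<^esub> a') \<otimes>\<^bsub>R Quot I\<^esub> d\<^sub>2 = d\<^sub>2"
      using F.hom_closed[OF d(1)] F.hom_closed[OF d(2)] F.hom_closed[OF d(3)] F.hom_closed[OF d(4)]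
      by blast
  qed
qed

lemma normalizerD:
  assumes "e \<in> normalizer G H" "H \<subseteq> carrier G" "x \<in> H"
  shows "e \<otimes>\<^bsub>G\<^esub> x \<otimes>\<^bsub>G\<^esub> inv\<^bsub>G\<^esub> e \<in> H"
proof -
  have "(e <#\<^bsub>G\<^esub> H) #>\<^bsub>G\<^esub> (inv\<^bsub>G\<^esub> e) = H"
    using assms(1,2) by (auto simp: normalizer_def stabilizer_def)
  then show ?thesis using assms(3) by (force simp: l_coset_def r_coset_def)
qed

context matrix_ring
begin

lemma red_transvection:
  assumes "ideal I R" "r \<in> carrier R"
  shows "red I (\<^bold>1 \<^bold>+ U i j r) =
    \<one>\<^bsub>mat_ring n (R Quot I)\<^esub> \<oplus>\<^bsub>mat_ring n (R Quot I)\<^esub> matrix_ring.U (R Quot I) n i j (I +> r)"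
proof -
  interpret F: ring_hom_ring M "mat_ring n (R Quot I)" "red I" using assms(1) by (rule red_hom)
  interpret I: ideal I R by fact
  have Q: "matrix_ring (R Quot I)" using I.quotient_is_ring by (simp add: matrix_ring_def)
  have "red I (U i j r) = matrix_ring.U (R Quot I) n i j (I +> r)"
    unfolding U_def matrix_ring.U_def[OF Q]
    using I.a_rcos_const by (intro eq_matI) (auto simp: FactRing_def)
  then show ?thesis using assms(2) by simp
qed

end

context splitting_matrix_ring
begin

lemma sandwich:
  assumes n: "n \<ge> 3" and G: "subgroup G (GL n R)"
    and G_conj: "\<And>t g. t \<in> E \<Longrightarrow> g \<in> G \<Longrightarrow> t \<cdot> g \<cdot> minv t \<in> G"
  shows "\<exists>I. ideal I R \<and> EI I \<subseteq> G \<and> G \<subseteq> congruence_full n R I"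
proof -
  note Gc = GL_subgroupD[OF G]
  have comm1: "t \<cdot> g \<cdot> minv t \<cdot> minv g \<in> G" if "t \<in> E" "g \<in> G" for t g
    using that by (intro Gc(3,4) G_conj)
  have comm2: "g \<cdot> t \<cdot> minv g \<cdot> minv t \<in> G" if "t \<in> E" "g \<in> G" for t g
  proof -
    have "g \<cdot> (t \<cdot> minv g \<cdot> minv t) \<in> G" using that by (intro Gc(3,4) G_conj)
    then show ?thesis using that Gc(1) E_closed(4) by (simp add: M.m_assoc M.Units_closed subset_iff)
  qed
  define T where "T i j x \<longleftrightarrow> \<^bold>1 \<^bold>+ U i j x \<in> G" for i j x
  have right: "T i k (x \<otimes> r)" if "T i j x" "i < n" "j < n" "k < n" "i \<noteq> j" "j \<noteq> k" "i \<noteq> k"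
    "x \<in> carrier R" "r \<in> carrier R" for i j k x r
    using comm2[of "\<^bold>1 \<^bold>+ U j k r" "\<^bold>1 \<^bold>+ U i j x"] that transvection_commutator[of i j k x r]
    by (simp add: T_def transvection_in_E)
  have left: "T i k (r \<otimes> x)" if "T j k x" "i < n" "j < n" "k < n" "i \<noteq> j" "j \<noteq> k" "i \<noteq> k"
    "x \<in> carrier R" "r \<in> carrier R" for i j k x r
    using comm1[of "\<^bold>1 \<^bold>+ U i j r" "\<^bold>1 \<^bold>+ U j k x"] that transvection_commutator[of i j k r x]
    by (simp add: T_def transvection_in_E)
  have col: "T i k x" if "T i j x" "i < n" "j < n" "k < n" "i \<noteq> j" "i \<noteq> k" "x \<in> carrier R" for i j k x
    using right[of i j x k \<one>] that by (cases "j = k") auto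
  have row: "T i k x" if "T j k x" "i < n" "j < n" "k < n" "j \<noteq> k" "i \<noteq> k" "x \<in> carrier R" for i j k x
    using left[of j k x i \<one>] that by (cases "i = j") auto
  \<comment> \<open>Change the column, then the row, then the column again; the index
    \<open>k\<close> keeps the position off the diagonal throughout.\<close>
  have move: "T i' j' x" if T: "T i j x" and ij: "i < n" "j < n" "i \<noteq> j" "i' < n" "j' < n" "i' \<noteq> j'"
    and x: "x \<in> carrier R" for i j i' j' x
  proof -
    obtain k where k: "k < n" "k \<noteq> i" "k \<noteq> i'" using third_index[OF n] by blast
    have "T i k x" using T ij k x by (intro col[of i j x k]) auto
    then have "T i' k x" using ij k x by (intro row[of i k x i']) auto
    then show ?thesis using ij k x by (intro col[of i' k x j']) auto
  qed
  \<comment> \<open>By \<open>move\<close> any other position could replace (0, 1). Going through a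
    third index allows multiplication by ring elements on either side.\<close>
  define I where "I = {x \<in> carrier R. T 0 1 x}"
  have n01: "0 < n" "1 < n" "2 < n" using n by auto
  have IT: "x \<in> I \<longleftrightarrow> x \<in> carrier R \<and> T i j x" if "i < n" "j < n" "i \<noteq> j" for i j x
    using move[of 0 1 x i j] move[of i j x 0 1] that n01 by (auto simp: I_def)
  have I: "ideal I R"
  proof (rule idealI[OF ring_axioms])
    show "subgroup I (add_monoid R)"
    proof (rule group.subgroupI[OF a_group])
      have "\<zero> \<in> I" using Gc(2) by (simp add: I_def T_def)
      then show "I \<noteq> {}" by blast
    next
      fix x assume x: "x \<in> I"
      then have "minv (\<^bold>1 \<^bold>+ U 0 1 x) \<in> G" by (intro Gc(4)) (simp add: I_def T_def)
      then have "\<ominus> x \<in> I"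
        using x n01 by (simp add: I_def T_def transvection_unit U_uminus M.minus_eq)
      then show "inv\<^bsub>add_monoid R\<^esub> x \<in> I" by (simp add: a_inv_def)
    next
      fix x y assume xy: "x \<in> I" "y \<in> I"
      then have "(\<^bold>1 \<^bold>+ U 0 1 x) \<cdot> (\<^bold>1 \<^bold>+ U 0 1 y) \<in> G" by (intro Gc(3)) (simp_all add: I_def T_def)
      also have "(\<^bold>1 \<^bold>+ U 0 1 x) \<cdot> (\<^bold>1 \<^bold>+ U 0 1 y) = \<^bold>1 \<^bold>+ U 0 1 (x \<oplus> y)"
        using xy n01 by (simp add: I_def M.l_distr M.r_distr U_mult_U U_add M.a_ac)
      finally show "x \<otimes>\<^bsub>add_monoid R\<^esub> y \<in> I" using xy by (simp add: I_def T_def)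
    qed (auto simp: I_def)
  next
    fix x r assume x: "x \<in> I" and r: "r \<in> carrier R"
    have xR: "x \<in> carrier R" "T 0 1 x" using x by (auto simp: I_def)
    have "T 0 2 (x \<otimes> r)" using xR r n01 by (intro right[of 0 1 x 2 r]) auto
    then show "x \<otimes> r \<in> I" using xR r n01 IT[of 0 2] by simp
    have "T 2 1 (r \<otimes> x)" using xR r n01 by (intro left[of 0 1 x 2 r]) auto
    then show "r \<otimes> x \<in> I" using xR r n01 IT[of 2 1] by simp
  qed
  interpret I: ideal I R by (rule I)
  interpret F: ring_hom_ring M "mat_ring n (R Quot I)" "red I" using I by (rule red_hom)
  have IR: "I \<subseteq> carrier R" using I.a_Hcarr by blast
  have EIG: "EI I \<subseteq> G"
  proof (rule elementary_ideal_minimal[OF IR G])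
    fix i j x assume "i < n" "j < n" "i \<noteq> j" "x \<in> I"
    then show "\<^bold>1 \<^bold>+ U i j x \<in> G" using IT[of i j x] by (simp add: T_def)
  qed (rule G_conj)
  let ?S = "R Quot I"
  have S: "matrix_ring ?S" using I.quotient_is_ring by (simp add: matrix_ring_def)
  have SX: "splitting_ring ?S" using I by (rule splitting_quotient)
  have sub: "subgroup (red I ` H) (GL n ?S)" if H: "subgroup H (GL n R)" for H
  proof -
    note Hc = GL_subgroupD[OF H]
    show ?thesis
    proof (rule matrix_ring.GL_subgroupI[OF S])
      show "red I ` H \<subseteq> Units (mat_ring n ?S)" using Hc(1) red_unit(1)[OF I] by blast
      show "\<one>\<^bsub>mat_ring n ?S\<^esub> \<in> red I ` H" using Hc(2) F.hom_one by (metis image_eqI)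
    next
      fix x y assume "x \<in> red I ` H" "y \<in> red I ` H"
      then obtain a b where ab: "a \<in> H" "b \<in> H" "x = red I a" "y = red I b" by blast
      moreover from ab have "a \<in> carrier M" "b \<in> carrier M" using Hc(1) by auto
      ultimately show "x \<otimes>\<^bsub>mat_ring n ?S\<^esub> y \<in> red I ` H"
        using Hc(3)[of a b] by (metis F.hom_mult image_eqI)
    next
      fix x assume "x \<in> red I ` H"
      then obtain a where a: "a \<in> H" "x = red I a" by blast
      then have "inv\<^bsub>mat_ring n ?S\<^esub> x = red I (minv a)"
        using Hc(1) red_unit(2)[OF I, of a] by blast
      then show "inv\<^bsub>mat_ring n ?S\<^esub> x \<in> red I ` H"
        using Hc(4)[OF a(1)] by simp
    qed
  qed
  \<comment> \<open>Cosets have representatives, so transvections over R / I lift to R, and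
    conjugation by E(n,R/I) lifts with them.\<close>
  have ES: "elementary_group n ?S \<subseteq> red I ` E"
    unfolding elementary_group_def[of n ?S]
  proof (rule matrix_ring.elementary_gen_minimal[OF S sub[OF E_subgroup]])
    fix i j s assume ij: "i < n" "j < n" "i \<noteq> j" and "s \<in> carrier ?S"
    then obtain r where r: "r \<in> carrier R" "s = I +> r" using quotient_representative by blast
    then show "\<one>\<^bsub>mat_ring n ?S\<^esub> \<oplus>\<^bsub>mat_ring n ?S\<^esub> matrix_ring.U ?S n i j s \<in> red I ` E"
      using ij red_transvection[OF I r(1), of i j] transvection_in_E by (metis image_eqI)
  qed
  have "transvection_free ?S n (red I ` G)"
  proof (intro transvection_free.intro transvection_free_axioms.intro S n sub[OF G])
    fix t g assume "t \<in> elementary_group n ?S" "g \<in> red I ` G"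
    then obtain t0 g0 where tg: "t0 \<in> E" "g0 \<in> G" "t = red I t0" "g = red I g0" using ES by blast
    then have U: "t0 \<in> Units M" "g0 \<in> Units M" using E_closed(4) Gc(1) by auto
    have "t \<otimes>\<^bsub>mat_ring n ?S\<^esub> g \<otimes>\<^bsub>mat_ring n ?S\<^esub> inv\<^bsub>mat_ring n ?S\<^esub> t = red I (t0 \<cdot> g0 \<cdot> minv t0)"
      using U red_unit(2)[OF I U(1)] tg by (simp add: M.Units_closed)
    then show "t \<otimes>\<^bsub>mat_ring n ?S\<^esub> g \<otimes>\<^bsub>mat_ring n ?S\<^esub> inv\<^bsub>mat_ring n ?S\<^esub> t \<in> red I ` G"
      using G_conj[OF tg(1,2)] by simp
  next
    fix i j s assume ij: "i < n" "j < n" "i \<noteq> j" and "s \<in> carrier ?S"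
      and sG: "\<one>\<^bsub>mat_ring n ?S\<^esub> \<oplus>\<^bsub>mat_ring n ?S\<^esub> matrix_ring.U ?S n i j s \<in> red I ` G"
    then obtain x where x: "x \<in> carrier R" "s = I +> x" using quotient_representative by blast
    define t where "t = \<^bold>1 \<^bold>+ U i j x"
    have tU: "t \<in> Units M" "t \<in> carrier M" using ij x transvection_unit by (auto simp: t_def)
    obtain g where g: "g \<in> G" "red I g = red I t"
      using sG red_transvection[OF I x(1), of i j] x(2) unfolding t_def by auto
    have gU: "g \<in> Units M" using g Gc(1) by blast
    \<comment> \<open>The discrepancy between \<open>t\<close> and an element \<open>g\<close> of
      \<open>G\<close> with the same reduction. It reduces to 1, so its commutator with
      \<open>v\<close> lies in E(n,I) and hence in \<open>G\<close>.\<close>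
    define c where "c = minv t \<cdot> g"
    have cU: "c \<in> Units M" using tU gU by (simp add: c_def)
    have "red I c = red I (minv t) \<otimes>\<^bsub>mat_ring n ?S\<^esub> red I t"
      using tU gU g(2) unfolding c_def by (simp add: M.Units_closed)
    also have "\<dots> = red I (minv t \<cdot> t)"
      using tU by (intro F.hom_mult[symmetric]) simp_all
    also have "minv t \<cdot> t = \<^bold>1" using tU(1) by simp
    finally have redc: "red I c = red I \<^bold>1" .
    have gtc: "g = t \<cdot> c" using tU gU by (simp add: c_def mat_simps)
    obtain k where k: "k < n" "k \<noteq> i" "k \<noteq> j" using third_index[OF n] by blast
    define v where "v = \<^bold>1 \<^bold>+ U j k \<one>"
    have v: "v \<in> E" "v \<in> Units M" using ij k by (simp_all add: v_def transvection_in_E transvection_unit)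
    have "c \<cdot> v \<cdot> minv c \<cdot> minv v \<in> EI I"
      unfolding v_def
      using ij k cU by (intro commutator_in_elementary_ideal[OF I cU]) (simp_all add: redc M.Units_closed)
    then have "t \<cdot> (c \<cdot> v \<cdot> minv c \<cdot> minv v) \<cdot> minv t \<in> EI I"
      by (rule elementary_ideal_conj[OF I tU(1)])
    then have 1: "minv (t \<cdot> (c \<cdot> v \<cdot> minv c \<cdot> minv v) \<cdot> minv t) \<in> G"
      using EIG by (intro Gc(4)) blast
    \<comment> \<open>The identity [t c, v] = t [c, v] t^-1 [t, v], solved for [t, v] =
      t_ik(x).\<close>
    have "t \<cdot> v \<cdot> minv t \<cdot> minv v =
        minv (t \<cdot> (c \<cdot> v \<cdot> minv c \<cdot> minv v) \<cdot> minv t) \<cdot> (g \<cdot> v \<cdot> minv g \<cdot> minv v)"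
      unfolding gtc using tU cU v by (simp add: minv_mult mat_simps)
    also have "\<dots> \<in> G" using 1 comm2[OF v(1) g(1)] by (rule Gc(3))
    finally have "T i k x"
      using ij k x transvection_commutator[of i j k x \<one>] by (simp add: T_def t_def v_def)
    then have "x \<in> I" using IT[of i k x] ij k x by simp
    then show "s = \<zero>\<^bsub>?S\<^esub>" using x I.a_rcos_const by (simp add: FactRing_def)
  qed
  then have "splitting_transvection_free ?S n (red I ` G)"
    using SX by (simp add: splitting_transvection_free_def)
  note central = splitting_transvection_free.central[OF this]
  have "G \<subseteq> congruence_full n R I"
  proof
    fix g assume g: "g \<in> G"
    then have gU: "g \<in> Units M" using Gc(1) by blast
    \<comment> \<open>The reduction of \<open>g\<close> commutes with every matrix over R / I, so it
      is central in all of GL(n,R/I), not only relative to the image of GL(n,R).\<close>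
    have "red I g \<in> center (GL n ?S)"
      using red_unit(1)[OF I gU] central[of "red I g"] g F.S.Units_closed
      by (auto simp: center_def GL_simps)
    with gU show "g \<in> congruence_full n R I" by (simp add: congruence_full_def GL_simps)
  qed
  with I EIG show ?thesis by blast
qed

end

theorem theorem3:
  fixes R (structure) and n :: nat
  assumes "n \<ge> 3"
    and "nearly_local_ring R"
  shows "stable_ring n R"
proof -
  interpret R: splitting_ring R
    using assms(2) by (rule nearly_local_ring.splitting_ring)
  interpret splitting_matrix_ring R n
    by (intro splitting_matrix_ring.intro matrix_ring.intro R.ring_axioms R.splitting_ring_axioms)
  have "normal_ring n R"
    unfolding normal_ring_def
  proof (intro allI impI)
    fix G assume *: "subgroup G (GL n R) \<and> elementary_group n R \<subseteq> normalizer (GL n R) G"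
    then have GU: "G \<subseteq> carrier (GL n R)" using subgroup.subset by blast
    have "t \<cdot> g \<cdot> minv t \<in> G" if "t \<in> E" "g \<in> G" for t g
    proof -
      have "t \<in> normalizer (GL n R) G" using * that by blast
      from normalizerD[OF this GU that(2)] show ?thesis
        using that(1) E_closed(4) by (simp add: GL_simps GL_inv)
    qed
    with * assms(1) show "\<exists>I. ideal I R \<and> EI I \<subseteq> G \<and> G \<subseteq> congruence_full n R I"
      by (intro sandwich) auto
  qed
  moreover have "commutator_ring n R"
    unfolding commutator_ring_def
    using assms(1) commutator_formula elementary_ideal_normal by blast
  ultimately show ?thesis
    unfolding stable_ring_def using R.ring_axioms by blast
qed

end
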